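(* Let $H$ be a Hopf $*$-algebra over $\mathbb{C}$, let $V$ be a left $H$-module, and let $(V_j)_{j\in J}$ be a family of left $H$-modules. (a) The map $\gamma:\overline{\mathbb{C}}\to\mathbb{C}$, $\gamma(c_{\mathbb{C}}(\lambda))=\bar\lambda$ (the usual complex conjugate of $\lambda$), is an isomorphism of $H$-modules. (b) The map $\sigma_V:\overline{\overline V}\to V$, $\bar{\bar v}\mapsto v$, is an isomorphism of $H$-modules. (c) The map $\pi:\overline{\bigoplus_{j\in J}V_j}\to\bigoplus_{j\in J}\overline{V_j}$, $\pi\big(\overline{(v_j)_{j\in J}}\big)=(\overline{v_j})_{j\in J}$, is an isomorphism of $H$-modules.
   Context: All vector spaces are over $\mathbb{C}$. A Hopf $*$-algebra is a Hopf algebra $H$ over $\mathbb{C}$ (coproduct $\Delta(a)=a_{(1)}\otimes a_{(2)}$, counit $\varepsilon$, antipode $S$) equipped with an antilinear map $*:H\to H$ such that $(a^* )^*=a$, $(ab)^*=b^*a^*$ and $\Delta(a^* )=a_{(1)}^*\otimes a_{(2)}^*$. The ground field $\mathbb{C}$ is an $H$-module via $a\rhd\lambda=\varepsilon(a)\lambda$. For a vector space $V$, the complex conjugate vector space $\overline{V}$ consists of formal symbols $c_V(v)=\bar v$ ($v\in V$) with $\bar v+\bar w=\overline{v+w}$ and $\lambda\cdot\bar v=\overline{\bar\lambda v}$. If $V$ is a left $H$-module, $\overline V$ is a left $H$-module via $a\rhd\bar v=\overline{S(a)^*\rhd v}$. *)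

theory Defs
  imports Complex_Main "HOL-Algebra.Module" "HOL-Algebra.AbelCoset" "HOL-Library.FuncSet"
begin

section \<open>Complex vector spaces\<close>

text \<open>
  Complex vector spaces are modules, in the sense of HOL-Algebra, over the following record.
  It serves both as the ground field and as the one-dimensional vector space over it. The record
  type of modules extends that of rings, so a plain vector space also carries the two fields
  \<open>mult\<close> and \<open>one\<close>; the locale \<^locale>\<open>module\<close> ignores them and they are left
  unspecified below.
\<close>

definition complex_alg :: "(complex, complex) module" where
  "complex_alg = \<lparr>carrier = UNIV, mult = (*), one = 1, zero = 0, add = (+), smult = (*)\<rparr>"

abbreviation vspace :: "(complex, 'v, 'm) module_scheme \<Rightarrow> bool" where
  "vspace V \<equiv> module complex_alg V"

definition linear_map ::
    "(complex, 'v, 'm) module_scheme \<Rightarrow> (complex, 'w, 'n) module_scheme \<Rightarrow> ('v \<Rightarrow> 'w) \<Rightarrow> bool" where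
  "linear_map V W f \<longleftrightarrow>
     f \<in> carrier V \<rightarrow> carrier W \<and>
     (\<forall>x\<in>carrier V. \<forall>y\<in>carrier V. f (x \<oplus>\<^bsub>V\<^esub> y) = f x \<oplus>\<^bsub>W\<^esub> f y) \<and>
     (\<forall>c. \<forall>x\<in>carrier V. f (c \<odot>\<^bsub>V\<^esub> x) = c \<odot>\<^bsub>W\<^esub> f x)"

definition antilinear_map ::
    "(complex, 'v, 'm) module_scheme \<Rightarrow> (complex, 'w, 'n) module_scheme \<Rightarrow> ('v \<Rightarrow> 'w) \<Rightarrow> bool" where
  "antilinear_map V W f \<longleftrightarrow>
     f \<in> carrier V \<rightarrow> carrier W \<and>
     (\<forall>x\<in>carrier V. \<forall>y\<in>carrier V. f (x \<oplus>\<^bsub>V\<^esub> y) = f x \<oplus>\<^bsub>W\<^esub> f y) \<and>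
     (\<forall>c. \<forall>x\<in>carrier V. f (c \<odot>\<^bsub>V\<^esub> x) = cnj c \<odot>\<^bsub>W\<^esub> f x)"

datatype 'v conj = Conj (unconj: 'v)

definition conj_space :: "(complex, 'v, 'm) module_scheme \<Rightarrow> (complex, 'v conj) module" where
  "conj_space V =
    \<lparr>carrier = Conj ` carrier V, mult = undefined, one = undefined, zero = Conj \<zero>\<^bsub>V\<^esub>,
     add = (\<lambda>x y. Conj (unconj x \<oplus>\<^bsub>V\<^esub> unconj y)),
     smult = (\<lambda>c x. Conj (cnj c \<odot>\<^bsub>V\<^esub> unconj x))\<rparr>"

definition direct_sum_space ::
    "'j set \<Rightarrow> ('j \<Rightarrow> (complex, 'v, 'm) module_scheme) \<Rightarrow> (complex, 'j \<Rightarrow> 'v) module" where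
  "direct_sum_space J V =
    \<lparr>carrier = {v \<in> (\<Pi>\<^sub>E j\<in>J. carrier (V j)). finite {j\<in>J. v j \<noteq> \<zero>\<^bsub>V j\<^esub>}},
     mult = undefined, one = undefined, zero = (\<lambda>j\<in>J. \<zero>\<^bsub>V j\<^esub>),
     add = (\<lambda>v w. \<lambda>j\<in>J. v j \<oplus>\<^bsub>V j\<^esub> w j),
     smult = (\<lambda>c v. \<lambda>j\<in>J. c \<odot>\<^bsub>V j\<^esub> v j)\<rparr>"


section \<open>Tensor products\<close>

text \<open>
  The tensor product of \<open>V\<close> and \<open>W\<close> is the free vector space on
  \<open>carrier V \<times> carrier W\<close> modulo the subspace spanned by the bilinearity relations, so
  its elements are cosets of finitely supported functions.
\<close>

type_synonym ('v, 'w) tensor = "('v \<times> 'w \<Rightarrow> complex) set"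

definition free_space :: "'x set \<Rightarrow> (complex, 'x \<Rightarrow> complex) module" where
  "free_space X = direct_sum_space X (\<lambda>_. complex_alg)"

definition free_basis :: "'x set \<Rightarrow> 'x \<Rightarrow> 'x \<Rightarrow> complex" where
  "free_basis X x = (\<lambda>y\<in>X. if y = x then 1 else 0)"

definition span_in :: "(complex, 'v, 'm) module_scheme \<Rightarrow> 'v set \<Rightarrow> 'v set" where
  "span_in V B = \<Inter>{N. submodule N complex_alg V \<and> B \<subseteq> N}"

text \<open>
  The coset of \<open>N\<close> is added in the scalar multiplication because \<open>0\<close> times a coset
  has to be \<open>N\<close> rather than the set consisting of zero only.
\<close>

definition quotient_space ::
    "(complex, 'v, 'm) module_scheme \<Rightarrow> 'v set \<Rightarrow> (complex, 'v set) module" where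
  "quotient_space V N =
    \<lparr>carrier = a_rcosets\<^bsub>V\<^esub> N, mult = undefined, one = undefined, zero = N,
     add = set_add V,
     smult = (\<lambda>c X. \<Union>x\<in>X. N +>\<^bsub>V\<^esub> (c \<odot>\<^bsub>V\<^esub> x))\<rparr>"

definition tensor_null ::
    "(complex, 'v, 'm) module_scheme \<Rightarrow> (complex, 'w, 'n) module_scheme \<Rightarrow> ('v, 'w) tensor" where
  "tensor_null V W =
    (let F = free_space (carrier V \<times> carrier W);
         e = (\<lambda>v w. free_basis (carrier V \<times> carrier W) (v, w))
     in span_in F
      ({e (v \<oplus>\<^bsub>V\<^esub> v') w \<ominus>\<^bsub>F\<^esub> (e v w \<oplus>\<^bsub>F\<^esub> e v' w) | v v' w.
          v \<in> carrier V \<and> v' \<in> carrier V \<and> w \<in> carrier W} \<union>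
       {e v (w \<oplus>\<^bsub>W\<^esub> w') \<ominus>\<^bsub>F\<^esub> (e v w \<oplus>\<^bsub>F\<^esub> e v w') | v w w'.
          v \<in> carrier V \<and> w \<in> carrier W \<and> w' \<in> carrier W} \<union>
       {e (c \<odot>\<^bsub>V\<^esub> v) w \<ominus>\<^bsub>F\<^esub> (c \<odot>\<^bsub>F\<^esub> e v w) | c v w. v \<in> carrier V \<and> w \<in> carrier W} \<union>
       {e v (c \<odot>\<^bsub>W\<^esub> w) \<ominus>\<^bsub>F\<^esub> (c \<odot>\<^bsub>F\<^esub> e v w) | c v w. v \<in> carrier V \<and> w \<in> carrier W}))"

definition tensor_space ::
    "(complex, 'v, 'm) module_scheme \<Rightarrow> (complex, 'w, 'n) module_scheme
      \<Rightarrow> (complex, ('v, 'w) tensor) module" where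
  "tensor_space V W = quotient_space (free_space (carrier V \<times> carrier W)) (tensor_null V W)"

definition pure_tensor ::
    "(complex, 'v, 'm) module_scheme \<Rightarrow> (complex, 'w, 'n) module_scheme
      \<Rightarrow> 'v \<Rightarrow> 'w \<Rightarrow> ('v, 'w) tensor" where
  "pure_tensor V W v w =
     tensor_null V W +>\<^bsub>free_space (carrier V \<times> carrier W)\<^esub>
       free_basis (carrier V \<times> carrier W) (v, w)"

text \<open>
  The linear map from the tensor product of \<open>V\<close> and \<open>W\<close> to \<open>M\<close> sending
  \<open>v \<otimes> w\<close> to \<open>B v w\<close>, for a bilinear \<open>B\<close>. Bilinearity makes the extension of
  \<open>B\<close> to the free vector space constant on each coset, so that its image is a singleton.
\<close>

definition tensor_lift ::
    "(complex, 'v, 'm) module_scheme \<Rightarrow> (complex, 'w, 'n) module_scheme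
      \<Rightarrow> (complex, 'a, 'k) module_scheme \<Rightarrow> ('v \<Rightarrow> 'w \<Rightarrow> 'a) \<Rightarrow> ('v, 'w) tensor \<Rightarrow> 'a" where
  "tensor_lift V W M B t =
     the_elem ((\<lambda>f. \<Oplus>\<^bsub>M\<^esub>p\<in>{p \<in> carrier V \<times> carrier W. f p \<noteq> 0}.
                      f p \<odot>\<^bsub>M\<^esub> B (fst p) (snd p)) ` t)"

definition tensor_map ::
    "(complex, 'v, 'm) module_scheme \<Rightarrow> (complex, 'w, 'n) module_scheme
      \<Rightarrow> (complex, 'a, 'k) module_scheme \<Rightarrow> (complex, 'b, 'l) module_scheme
      \<Rightarrow> ('v \<Rightarrow> 'a) \<Rightarrow> ('w \<Rightarrow> 'b) \<Rightarrow> ('v, 'w) tensor \<Rightarrow> ('a, 'b) tensor" where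
  "tensor_map V W A B f g =
     tensor_lift V W (tensor_space A B) (\<lambda>v w. pure_tensor A B (f v) (g w))"

text \<open>
  For antilinear \<open>f\<close> and \<open>g\<close>, the map \<open>v \<otimes> w \<mapsto> f v \<otimes> g w\<close> is antilinear,
  i.e. linear into the conjugate of the target.
\<close>

definition antilinear_tensor_map ::
    "(complex, 'v, 'm) module_scheme \<Rightarrow> (complex, 'w, 'n) module_scheme
      \<Rightarrow> (complex, 'a, 'k) module_scheme \<Rightarrow> (complex, 'b, 'l) module_scheme
      \<Rightarrow> ('v \<Rightarrow> 'a) \<Rightarrow> ('w \<Rightarrow> 'b) \<Rightarrow> ('v, 'w) tensor \<Rightarrow> ('a, 'b) tensor" where
  "antilinear_tensor_map V W A B f g t =
     unconj (tensor_lift V W (conj_space (tensor_space A B))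
       (\<lambda>v w. Conj (pure_tensor A B (f v) (g w))) t)"

definition tensor_assoc ::
    "(complex, 'u, 'm) module_scheme \<Rightarrow> (complex, 'v, 'n) module_scheme
      \<Rightarrow> (complex, 'w, 'k) module_scheme
      \<Rightarrow> (('u, 'v) tensor, 'w) tensor \<Rightarrow> ('u, ('v, 'w) tensor) tensor" where
  "tensor_assoc U V W =
     (let T = tensor_space U (tensor_space V W) in
      tensor_lift (tensor_space U V) W T
        (\<lambda>t w. tensor_lift U V T
           (\<lambda>u v. pure_tensor U (tensor_space V W) u (pure_tensor V W v w)) t))"

definition tensor_alg ::
    "(complex, 'a, 'm) module_scheme \<Rightarrow> (complex, ('a, 'a) tensor) module" where
  "tensor_alg A = (tensor_space A A)
    \<lparr>mult := (\<lambda>s t. tensor_lift A A (tensor_space A A)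
        (\<lambda>a b. tensor_lift A A (tensor_space A A)
           (\<lambda>a' b'. pure_tensor A A (a \<otimes>\<^bsub>A\<^esub> a') (b \<otimes>\<^bsub>A\<^esub> b')) t) s),
     one := pure_tensor A A \<one>\<^bsub>A\<^esub> \<one>\<^bsub>A\<^esub>\<rparr>"


section \<open>Hopf star-algebras\<close>

record 'h hopf_star = "(complex, 'h) module" +
  comult :: "'h \<Rightarrow> ('h, 'h) tensor"
  counit :: "'h \<Rightarrow> complex"
  antipode :: "'h \<Rightarrow> 'h"
  star :: "'h \<Rightarrow> 'h"

text \<open>The library locale \<^locale>\<open>algebra\<close> is restricted to commutative algebras.\<close>

locale complex_algebra = ring H + module complex_alg H
  for H :: "(complex, 'h, 'm) module_scheme" (structure) +
  assumes smult_mult_left: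
      "\<lbrakk>x \<in> carrier H; y \<in> carrier H\<rbrakk> \<Longrightarrow> (c \<odot> x) \<otimes> y = c \<odot> (x \<otimes> y)"
    and smult_mult_right:
      "\<lbrakk>x \<in> carrier H; y \<in> carrier H\<rbrakk> \<Longrightarrow> x \<otimes> (c \<odot> y) = c \<odot> (x \<otimes> y)"

text \<open>
  In Sweedler notation, \<open>tensor_lift H H H B (comult H a)\<close> is the sum of
  \<open>B a\<^sub>(\<^sub>1\<^sub>) a\<^sub>(\<^sub>2\<^sub>)\<close>. The counit axioms use it to identify the tensor product of the
  ground field and \<open>H\<close> with \<open>H\<close>.
\<close>

locale hopf_algebra = complex_algebra H
  for H :: "('h, 'm) hopf_star_scheme" (structure) +
  assumes comult_linear: "linear_map H (tensor_space H H) (comult H)"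
    and counit_linear: "linear_map H complex_alg (counit H)"
    and coassoc: "a \<in> carrier H \<Longrightarrow>
      tensor_assoc H H H
        (tensor_map H H (tensor_space H H) H (comult H) (\<lambda>x. x) (comult H a)) =
      tensor_map H H H (tensor_space H H) (\<lambda>x. x) (comult H) (comult H a)"
    and counit_left: "a \<in> carrier H \<Longrightarrow>
      tensor_lift H H H (\<lambda>x y. counit H x \<odot> y) (comult H a) = a"
    and counit_right: "a \<in> carrier H \<Longrightarrow>
      tensor_lift H H H (\<lambda>x y. counit H y \<odot> x) (comult H a) = a"
    and comult_hom: "comult H \<in> ring_hom H (tensor_alg H)"
    and counit_hom: "counit H \<in> ring_hom H complex_alg"
    and antipode_linear: "linear_map H H (antipode H)"
    and antipode_left: "a \<in> carrier H \<Longrightarrow>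
      tensor_lift H H H (\<lambda>x y. antipode H x \<otimes> y) (comult H a) = counit H a \<odot> \<one>"
    and antipode_right: "a \<in> carrier H \<Longrightarrow>
      tensor_lift H H H (\<lambda>x y. x \<otimes> antipode H y) (comult H a) = counit H a \<odot> \<one>"

locale hopf_star_algebra = hopf_algebra H
  for H :: "('h, 'm) hopf_star_scheme" (structure) +
  assumes star_antilinear: "antilinear_map H H (star H)"
    and star_star: "a \<in> carrier H \<Longrightarrow> star H (star H a) = a"
    and star_mult: "\<lbrakk>a \<in> carrier H; b \<in> carrier H\<rbrakk> \<Longrightarrow> star H (a \<otimes> b) = star H b \<otimes> star H a"
    and star_comult: "a \<in> carrier H \<Longrightarrow>
      comult H (star H a) = antilinear_tensor_map H H H H (star H) (star H) (comult H a)"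


section \<open>Left modules\<close>

record ('h, 'v) hmod = "(complex, 'v) module" +
  act :: "'h \<Rightarrow> 'v \<Rightarrow> 'v"  (infixr \<open>\<rhd>\<index>\<close> 75)

abbreviation with_act :: "(complex, 'v) module \<Rightarrow> ('h \<Rightarrow> 'v \<Rightarrow> 'v) \<Rightarrow> ('h, 'v) hmod" where
  "with_act V r \<equiv> module.extend V (hmod.fields r)"

definition hmodule :: "(complex, 'h, 'm) module_scheme \<Rightarrow> ('h, 'v) hmod \<Rightarrow> bool" where
  "hmodule H V \<longleftrightarrow> vspace V \<and>
     (\<forall>a\<in>carrier H. linear_map V V (\<lambda>v. a \<rhd>\<^bsub>V\<^esub> v)) \<and>
     (\<forall>v\<in>carrier V. linear_map H V (\<lambda>a. a \<rhd>\<^bsub>V\<^esub> v)) \<and>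
     (\<forall>a\<in>carrier H. \<forall>b\<in>carrier H. \<forall>v\<in>carrier V.
        (a \<otimes>\<^bsub>H\<^esub> b) \<rhd>\<^bsub>V\<^esub> v = a \<rhd>\<^bsub>V\<^esub> b \<rhd>\<^bsub>V\<^esub> v) \<and>
     (\<forall>v\<in>carrier V. \<one>\<^bsub>H\<^esub> \<rhd>\<^bsub>V\<^esub> v = v)"

definition hmodule_hom ::
    "(complex, 'h, 'm) module_scheme \<Rightarrow> ('h, 'v) hmod \<Rightarrow> ('h, 'w) hmod \<Rightarrow> ('v \<Rightarrow> 'w) \<Rightarrow> bool" where
  "hmodule_hom H V W f \<longleftrightarrow> hmodule H V \<and> hmodule H W \<and> linear_map V W f \<and>
     (\<forall>a\<in>carrier H. \<forall>v\<in>carrier V. f (a \<rhd>\<^bsub>V\<^esub> v) = a \<rhd>\<^bsub>W\<^esub> f v)"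

definition hmodule_iso ::
    "(complex, 'h, 'm) module_scheme \<Rightarrow> ('h, 'v) hmod \<Rightarrow> ('h, 'w) hmod \<Rightarrow> ('v \<Rightarrow> 'w) \<Rightarrow> bool" where
  "hmodule_iso H V W f \<longleftrightarrow> hmodule_hom H V W f \<and> bij_betw f (carrier V) (carrier W)"

definition trivial_hmod :: "('h, 'm) hopf_star_scheme \<Rightarrow> ('h, complex) hmod" where
  "trivial_hmod H = with_act complex_alg (\<lambda>a z. counit H a * z)"

definition conj_hmod ::
    "('h, 'm) hopf_star_scheme \<Rightarrow> ('h, 'v) hmod \<Rightarrow> ('h, 'v conj) hmod" where
  "conj_hmod H V = with_act (conj_space V)
     (\<lambda>a x. Conj (star H (antipode H a) \<rhd>\<^bsub>V\<^esub> unconj x))"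

definition direct_sum_hmod :: "'j set \<Rightarrow> ('j \<Rightarrow> ('h, 'v) hmod) \<Rightarrow> ('h, 'j \<Rightarrow> 'v) hmod" where
  "direct_sum_hmod J V = with_act (direct_sum_space J V)
     (\<lambda>a v. \<lambda>j\<in>J. a \<rhd>\<^bsub>V j\<^esub> v j)"

fun gamma_map :: "complex conj \<Rightarrow> complex" where
  "gamma_map (Conj z) = cnj z"

fun sigma_map :: "'v conj conj \<Rightarrow> 'v" where
  "sigma_map (Conj (Conj v)) = v"

fun pi_map :: "'j set \<Rightarrow> ('j \<Rightarrow> 'v) conj \<Rightarrow> 'j \<Rightarrow> 'v conj" where
  "pi_map J (Conj v) = (\<lambda>j\<in>J. Conj (v j))"

end

theory Submission
  imports Defs
begin

text \<open>
  All three maps are visibly bijective and linear. The content lies in the action on conjugate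
  spaces, where \<open>a\<close> sends the conjugate of \<open>v\<close> to the conjugate of \<open>S(a)\<^sup>* \<rhd> v\<close>: this has to be an
  action at all, and the maps have to respect it.
  This comes down to a few identities in a Hopf star-algebra.

  \<^item> \<open>S(a b) = S(b) S(a)\<close> and \<open>S(1) = 1\<close>, so that \<open>a \<mapsto> S(a)\<^sup>*\<close> is multiplicative and unital and
    conjugate modules are modules;
  \<^item> \<open>\<epsilon>(S(a)) = \<epsilon>(a)\<close> and \<open>\<epsilon>(a\<^sup>*) = cnj (\<epsilon>(a))\<close>, which make \<open>\<gamma>\<close> equivariant;
  \<^item> \<open>S(S(a)\<^sup>*)\<^sup>* = a\<close>, which makes \<open>\<sigma>\<close> equivariant.

  For \<open>\<pi>\<close> both sides carry the same componentwise twist, and only the finiteness of supports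
  has to be followed through.

  The values of the counit on \<open>S(a)\<close> and of \<open>S\<close> on \<open>1\<close> come directly from the antipode law. The
  other identities are instances of the uniqueness of inverses or units for convolution. If
  \<open>f\<close> is a left and \<open>g\<close> a right convolution inverse of the same map, then \<open>f = g\<close> by
  coassociativity. Antimultiplicativity compares two inverses of the multiplication
  (\<open>antipode_mult\<close>), the last identity compares \<open>a \<mapsto> S(S(a\<^sup>*)\<^sup>*)\<close> with the identity as inverses of
  \<open>S\<close> (\<open>antipode_star_antipode_star\<close>), and \<open>counit_star\<close> compares two counits.

  To carry out these computations on elements, the coproduct of each \<open>a\<close> is written as a finite sum
  of pure tensors. The universal property of the tensor product (\<open>tensor_generated\<close>,
  \<open>tensor_lift_pure\<close> and \<open>linear_map_tensor_lift\<close>) turns every axiom about the coproduct into an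
  equation between such sums for an arbitrary multilinear map with values in an arbitrary vector
  space: \<open>sweedler_mult\<close>, \<open>sweedler_coassoc\<close>, \<open>sweedler_star\<close>.
\<close>

section \<open>Vector spaces and linear maps\<close>

lemma complex_alg_sel [simp]:
  "carrier complex_alg = UNIV" "x \<otimes>\<^bsub>complex_alg\<^esub> y = x * y" "\<one>\<^bsub>complex_alg\<^esub> = 1"
  "\<zero>\<^bsub>complex_alg\<^esub> = 0" "x \<oplus>\<^bsub>complex_alg\<^esub> y = x + y" "c \<odot>\<^bsub>complex_alg\<^esub> x = c * x"
  by (simp_all add: complex_alg_def)

lemma cring_complex_alg: "cring complex_alg"
proof (rule cringI)
  show "abelian_group complex_alg"
    by (rule abelian_groupI) (auto intro: exI[of _ "- x" for x])
  show "comm_monoid complex_alg"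
    by (rule comm_monoidI) auto
qed (simp add: distrib_right)

text \<open>Negation is scalar multiplication by \<open>-1\<close>, so the group axioms for addition reduce to those
  of a commutative monoid once \<open>0\<close> is known to annihilate every vector.\<close>

lemma vspaceI:
  fixes M (structure)
  assumes "\<And>x y. x \<in> carrier M \<Longrightarrow> y \<in> carrier M \<Longrightarrow> x \<oplus> y \<in> carrier M"
    and "\<And>x y z. x \<in> carrier M \<Longrightarrow> y \<in> carrier M \<Longrightarrow> z \<in> carrier M \<Longrightarrow> (x \<oplus> y) \<oplus> z = x \<oplus> (y \<oplus> z)"
    and "\<And>x y. x \<in> carrier M \<Longrightarrow> y \<in> carrier M \<Longrightarrow> x \<oplus> y = y \<oplus> x"
    and "\<zero> \<in> carrier M"
    and "\<And>x. x \<in> carrier M \<Longrightarrow> \<zero> \<oplus> x = x"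
    and closed: "\<And>c x. x \<in> carrier M \<Longrightarrow> c \<odot> x \<in> carrier M"
    and distr: "\<And>b c x. x \<in> carrier M \<Longrightarrow> (b + c) \<odot> x = (b \<odot> x) \<oplus> (c \<odot> x)"
    and "\<And>c x y. x \<in> carrier M \<Longrightarrow> y \<in> carrier M \<Longrightarrow> c \<odot> (x \<oplus> y) = (c \<odot> x) \<oplus> (c \<odot> y)"
    and "\<And>b c x. x \<in> carrier M \<Longrightarrow> (b * c) \<odot> x = b \<odot> (c \<odot> x)"
    and one: "\<And>x. x \<in> carrier M \<Longrightarrow> 1 \<odot> x = x"
    and zero: "\<And>x. x \<in> carrier M \<Longrightarrow> 0 \<odot> x = \<zero>"
  shows "vspace M"
proof (rule moduleI)
  have "\<exists>y\<in>carrier M. y \<oplus> x = \<zero>" if x: "x \<in> carrier M" for x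
  proof
    show "(-1) \<odot> x \<in> carrier M" by (rule closed[OF x])
    show "(-1) \<odot> x \<oplus> x = \<zero>" using distr[OF x, of "-1" 1] one[OF x] zero[OF x] by simp
  qed
  then show "abelian_group M" by (intro abelian_groupI)
      (erule (2) assms | erule (1) assms | erule assms | rule assms)+
qed (auto simp: assms cring_complex_alg)

lemma vspaceD:
  fixes M (structure)
  assumes "vspace M"
  shows vspace_add_closed: "x \<in> carrier M \<Longrightarrow> y \<in> carrier M \<Longrightarrow> x \<oplus> y \<in> carrier M"
    and vspace_assoc: "x \<in> carrier M \<Longrightarrow> y \<in> carrier M \<Longrightarrow> z \<in> carrier M \<Longrightarrow> (x \<oplus> y) \<oplus> z = x \<oplus> (y \<oplus> z)"
    and vspace_comm: "x \<in> carrier M \<Longrightarrow> y \<in> carrier M \<Longrightarrow> x \<oplus> y = y \<oplus> x"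
    and vspace_lcomm: "x \<in> carrier M \<Longrightarrow> y \<in> carrier M \<Longrightarrow> z \<in> carrier M \<Longrightarrow> x \<oplus> (y \<oplus> z) = y \<oplus> (x \<oplus> z)"
    and vspace_zero_closed: "\<zero> \<in> carrier M"
    and vspace_l_zero: "x \<in> carrier M \<Longrightarrow> \<zero> \<oplus> x = x"
    and vspace_r_zero: "x \<in> carrier M \<Longrightarrow> x \<oplus> \<zero> = x"
    and vspace_smult_closed: "x \<in> carrier M \<Longrightarrow> c \<odot> x \<in> carrier M"
    and vspace_distr_left: "x \<in> carrier M \<Longrightarrow> (b + c) \<odot> x = (b \<odot> x) \<oplus> (c \<odot> x)"
    and vspace_distr_right: "x \<in> carrier M \<Longrightarrow> y \<in> carrier M \<Longrightarrow> c \<odot> (x \<oplus> y) = (c \<odot> x) \<oplus> (c \<odot> y)"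
    and vspace_smult_smult: "x \<in> carrier M \<Longrightarrow> b \<odot> (c \<odot> x) = (b * c) \<odot> x"
    and vspace_smult_one: "x \<in> carrier M \<Longrightarrow> 1 \<odot> x = x"
    and vspace_smult_zero: "x \<in> carrier M \<Longrightarrow> 0 \<odot> x = \<zero>"
    and vspace_smult_zero_right: "c \<odot> \<zero> = \<zero>"
    and vspace_minus: "x \<in> carrier M \<Longrightarrow> \<ominus> x = (-1) \<odot> x"
proof -
  interpret M: module complex_alg M by fact
  show "x \<in> carrier M \<Longrightarrow> y \<in> carrier M \<Longrightarrow> x \<oplus> y \<in> carrier M"
    "x \<in> carrier M \<Longrightarrow> y \<in> carrier M \<Longrightarrow> z \<in> carrier M \<Longrightarrow> (x \<oplus> y) \<oplus> z = x \<oplus> (y \<oplus> z)"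
    "x \<in> carrier M \<Longrightarrow> y \<in> carrier M \<Longrightarrow> x \<oplus> y = y \<oplus> x"
    "x \<in> carrier M \<Longrightarrow> y \<in> carrier M \<Longrightarrow> z \<in> carrier M \<Longrightarrow> x \<oplus> (y \<oplus> z) = y \<oplus> (x \<oplus> z)"
    "\<zero> \<in> carrier M" "x \<in> carrier M \<Longrightarrow> \<zero> \<oplus> x = x" "x \<in> carrier M \<Longrightarrow> x \<oplus> \<zero> = x"
    by (auto simp: M.M.a_ac)
  show "x \<in> carrier M \<Longrightarrow> c \<odot> x \<in> carrier M" using M.smult_closed[of c x] by simp
  show distr: "x \<in> carrier M \<Longrightarrow> (b + c) \<odot> x = (b \<odot> x) \<oplus> (c \<odot> x)" for b c
    using M.smult_l_distr[of b c x] by simp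
  show "x \<in> carrier M \<Longrightarrow> y \<in> carrier M \<Longrightarrow> c \<odot> (x \<oplus> y) = (c \<odot> x) \<oplus> (c \<odot> y)"
    using M.smult_r_distr[of c x y] by simp
  show "x \<in> carrier M \<Longrightarrow> b \<odot> (c \<odot> x) = (b * c) \<odot> x" using M.smult_assoc1[of b c x] by simp
  show one: "x \<in> carrier M \<Longrightarrow> 1 \<odot> x = x" using M.smult_one[of x] by simp
  show zero: "x \<in> carrier M \<Longrightarrow> 0 \<odot> x = \<zero>" using M.smult_l_null[of x] by simp
  show "c \<odot> \<zero> = \<zero>" using M.smult_r_null[of c] by simp
  show "x \<in> carrier M \<Longrightarrow> \<ominus> x = (-1) \<odot> x"
  proof (rule M.M.minus_equality)
    assume x: "x \<in> carrier M"
    show "(-1) \<odot> x \<in> carrier M" using M.smult_closed[of "-1" x] x by simp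
    show "(-1) \<odot> x \<oplus> x = \<zero>" using distr[OF x, of "-1" 1] one[OF x] zero[OF x] by simp
  qed
qed

lemma vspace_complex_alg: "vspace complex_alg"
  by (rule vspaceI) (auto simp: algebra_simps)

lemma linear_mapI:
  assumes "\<And>x. x \<in> carrier V \<Longrightarrow> f x \<in> carrier W"
    and "\<And>x y. x \<in> carrier V \<Longrightarrow> y \<in> carrier V \<Longrightarrow> f (x \<oplus>\<^bsub>V\<^esub> y) = f x \<oplus>\<^bsub>W\<^esub> f y"
    and "\<And>c x. x \<in> carrier V \<Longrightarrow> f (c \<odot>\<^bsub>V\<^esub> x) = c \<odot>\<^bsub>W\<^esub> f x"
  shows "linear_map V W f"
  using assms by (auto simp: linear_map_def)

lemma linear_mapD:
  assumes "linear_map V W f"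
  shows linear_map_closed: "x \<in> carrier V \<Longrightarrow> f x \<in> carrier W"
    and linear_map_add: "x \<in> carrier V \<Longrightarrow> y \<in> carrier V \<Longrightarrow> f (x \<oplus>\<^bsub>V\<^esub> y) = f x \<oplus>\<^bsub>W\<^esub> f y"
    and linear_map_smult: "x \<in> carrier V \<Longrightarrow> f (c \<odot>\<^bsub>V\<^esub> x) = c \<odot>\<^bsub>W\<^esub> f x"
  using assms by (auto simp: linear_map_def)

lemma linear_map_zero:
  assumes "linear_map V W f" "vspace V" "vspace W"
  shows "f \<zero>\<^bsub>V\<^esub> = \<zero>\<^bsub>W\<^esub>"
proof -
  have "f (0 \<odot>\<^bsub>V\<^esub> \<zero>\<^bsub>V\<^esub>) = 0 \<odot>\<^bsub>W\<^esub> f \<zero>\<^bsub>V\<^esub>"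
    using assms by (auto intro: linear_map_smult vspace_zero_closed)
  then show ?thesis using assms
    by (simp add: vspace_smult_zero_right vspace_smult_zero linear_map_closed vspace_zero_closed)
qed

lemma linear_map_diff:
  assumes f: "linear_map V W f" and V: "vspace V" and W: "vspace W"
    and x: "x \<in> carrier V" and y: "y \<in> carrier V"
  shows "f (x \<ominus>\<^bsub>V\<^esub> y) = f x \<ominus>\<^bsub>W\<^esub> f y"
  using x y by (simp add: a_minus_def vspace_minus[OF V] vspace_minus[OF W] linear_mapD[OF f]
      vspace_smult_closed[OF V])

lemma vspace_diff_eq_zero:
  assumes "vspace W" "x \<in> carrier W"
  shows "x \<ominus>\<^bsub>W\<^esub> x = \<zero>\<^bsub>W\<^esub>"
proof -
  interpret W: module complex_alg W by fact
  show ?thesis using assms(2) by (simp add: a_minus_def W.M.r_neg)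
qed

lemma linear_map_id: "linear_map V V (\<lambda>x. x)"
  by (simp add: linear_map_def)

lemma linear_map_comp: "linear_map W X g \<Longrightarrow> linear_map V W f \<Longrightarrow> linear_map V X (\<lambda>x. g (f x))"
  by (auto simp: linear_map_def Pi_iff)

lemma linear_map_smult_const:
  assumes "linear_map V W f" "vspace W"
  shows "linear_map V W (\<lambda>x. c \<odot>\<^bsub>W\<^esub> f x)"
  by (rule linear_mapI)
    (use assms in \<open>simp_all add: linear_mapD vspaceD mult.commute\<close>)

lemma linear_map_smult_fun:
  assumes "linear_map V complex_alg f" "vspace W" "w \<in> carrier W"
  shows "linear_map V W (\<lambda>x. f x \<odot>\<^bsub>W\<^esub> w)"
  by (rule linear_mapI)
    (use assms in \<open>simp_all add: linear_mapD vspaceD\<close>)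

lemma linear_map_cong:
  assumes "linear_map V W f" "\<And>x. x \<in> carrier V \<Longrightarrow> f x = g x" "vspace V"
  shows "linear_map V W g"
  by (rule linear_mapI) (use assms in \<open>auto simp: linear_map_def vspaceD Pi_iff\<close>)


section \<open>Sums over lists\<close>

text \<open>Lists rather than finite sets index the sums, because the same pure tensor may occur
  several times as a summand of a tensor.\<close>

primrec list_sum :: "(complex, 'm, 'k) module_scheme \<Rightarrow> ('x \<Rightarrow> 'm) \<Rightarrow> 'x list \<Rightarrow> 'm" where
  "list_sum M f [] = \<zero>\<^bsub>M\<^esub>"
| "list_sum M f (x # xs) = f x \<oplus>\<^bsub>M\<^esub> list_sum M f xs"

lemma list_sum_closed:
  "vspace M \<Longrightarrow> (\<And>x. x \<in> set xs \<Longrightarrow> f x \<in> carrier M) \<Longrightarrow> list_sum M f xs \<in> carrier M"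
  by (induction xs) (auto simp: vspaceD)

lemma list_sum_cong [cong]:
  "xs = ys \<Longrightarrow> (\<And>x. x \<in> set ys \<Longrightarrow> f x = g x) \<Longrightarrow> list_sum M f xs = list_sum M g ys"
  by (induction ys arbitrary: xs) auto

lemma list_sum_zero: "vspace M \<Longrightarrow> list_sum M (\<lambda>x. \<zero>\<^bsub>M\<^esub>) xs = \<zero>\<^bsub>M\<^esub>"
  by (induction xs) (auto simp: vspaceD)

lemma list_sum_add:
  assumes "vspace M" "\<And>x. x \<in> set xs \<Longrightarrow> f x \<in> carrier M" "\<And>x. x \<in> set xs \<Longrightarrow> g x \<in> carrier M"
  shows "list_sum M (\<lambda>x. f x \<oplus>\<^bsub>M\<^esub> g x) xs = list_sum M f xs \<oplus>\<^bsub>M\<^esub> list_sum M g xs"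
  using assms(2,3)
proof (induction xs)
  case (Cons x xs)
  have "list_sum M f xs \<in> carrier M" "list_sum M g xs \<in> carrier M"
    using Cons.prems by (auto intro!: list_sum_closed assms(1))
  then show ?case using Cons
    by (simp add: vspace_assoc[OF assms(1)] vspace_lcomm[OF assms(1)] vspace_add_closed[OF assms(1)])
qed (simp add: vspaceD[OF assms(1)])

lemma linear_map_list_sum:
  assumes "linear_map M N h" "vspace M" "vspace N" "\<And>x. x \<in> set xs \<Longrightarrow> f x \<in> carrier M"
  shows "h (list_sum M f xs) = list_sum N (\<lambda>x. h (f x)) xs"
  using assms(4)
  by (induction xs) (auto simp: linear_map_zero[OF assms(1-3)] linear_map_add[OF assms(1)] list_sum_closed[OF assms(2)])

lemma list_sum_swap:
  assumes "vspace M" "\<And>x y. x \<in> set xs \<Longrightarrow> y \<in> set ys \<Longrightarrow> f x y \<in> carrier M"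
  shows "list_sum M (\<lambda>x. list_sum M (f x) ys) xs = list_sum M (\<lambda>y. list_sum M (\<lambda>x. f x y) xs) ys"
  using assms(2)
proof (induction xs)
  case (Cons x xs)
  have "list_sum M (\<lambda>y. list_sum M (\<lambda>x. f x y) (x # xs)) ys
      = list_sum M (\<lambda>y. f x y \<oplus>\<^bsub>M\<^esub> list_sum M (\<lambda>x. f x y) xs) ys" by simp
  also have "\<dots> = list_sum M (f x) ys \<oplus>\<^bsub>M\<^esub> list_sum M (\<lambda>y. list_sum M (\<lambda>x. f x y) xs) ys"
    by (rule list_sum_add[OF assms(1)]) (auto intro!: list_sum_closed assms(1) Cons.prems)
  finally show ?case using Cons by simp
qed (simp add: list_sum_zero[OF assms(1)])

lemma linear_map_list_sum_fun:
  assumes "vspace V" "vspace W" "\<And>p. p \<in> set ps \<Longrightarrow> linear_map V W (\<lambda>x. f x p)"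
  shows "linear_map V W (\<lambda>x. list_sum W (f x) ps)"
  using assms(3)
proof (induction ps)
  case Nil
  then show ?case using assms(1,2) by (auto simp: linear_map_def vspaceD)
next
  case (Cons p ps)
  then have l: "linear_map V W (\<lambda>x. f x p)" "linear_map V W (\<lambda>x. list_sum W (f x) ps)" by auto
  show ?case
    by (rule linear_mapI)
      (use linear_mapD[OF l(1)] linear_mapD[OF l(2)] assms(1,2) in
        \<open>simp_all add: vspace_add_closed vspace_assoc vspace_lcomm vspace_distr_right\<close>)
qed


section \<open>Constructions of vector spaces\<close>

lemma conj_space_sel [simp]:
  "carrier (conj_space V) = Conj ` carrier V" "\<zero>\<^bsub>conj_space V\<^esub> = Conj \<zero>\<^bsub>V\<^esub>"
  "x \<oplus>\<^bsub>conj_space V\<^esub> y = Conj (unconj x \<oplus>\<^bsub>V\<^esub> unconj y)"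
  "c \<odot>\<^bsub>conj_space V\<^esub> x = Conj (cnj c \<odot>\<^bsub>V\<^esub> unconj x)"
  by (simp_all add: conj_space_def)

lemma vspace_conj_space: "vspace V \<Longrightarrow> vspace (conj_space V)"
  by (rule vspaceI) (auto simp: vspaceD)

lemma direct_sum_space_sel [simp]:
  "v \<in> carrier (direct_sum_space J V) \<longleftrightarrow> v \<in> (\<Pi>\<^sub>E j\<in>J. carrier (V j)) \<and> finite {j\<in>J. v j \<noteq> \<zero>\<^bsub>V j\<^esub>}"
  "\<zero>\<^bsub>direct_sum_space J V\<^esub> = (\<lambda>j\<in>J. \<zero>\<^bsub>V j\<^esub>)"
  "v \<oplus>\<^bsub>direct_sum_space J V\<^esub> w = (\<lambda>j\<in>J. v j \<oplus>\<^bsub>V j\<^esub> w j)"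
  "c \<odot>\<^bsub>direct_sum_space J V\<^esub> v = (\<lambda>j\<in>J. c \<odot>\<^bsub>V j\<^esub> v j)"
  by (simp_all add: direct_sum_space_def)

lemma vspace_direct_sum_space:
  assumes V: "\<And>j. j \<in> J \<Longrightarrow> vspace (V j)"
  shows "vspace (direct_sum_space J V)"
proof -
  have mem: "v j \<in> carrier (V j)" if "v \<in> (\<Pi>\<^sub>E j\<in>J. carrier (V j))" "j \<in> J" for v j
    using that by auto
  have eqI: "v = w" if "v \<in> carrier (direct_sum_space J V)" "w \<in> carrier (direct_sum_space J V)"
    "\<And>j. j \<in> J \<Longrightarrow> v j = w j" for v w
    using that by (auto intro: PiE_ext)
  have add: "v \<oplus>\<^bsub>direct_sum_space J V\<^esub> w \<in> carrier (direct_sum_space J V)"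
    if "v \<in> carrier (direct_sum_space J V)" "w \<in> carrier (direct_sum_space J V)" for v w
  proof -
    have "{j \<in> J. (\<lambda>j\<in>J. v j \<oplus>\<^bsub>V j\<^esub> w j) j \<noteq> \<zero>\<^bsub>V j\<^esub>}
        \<subseteq> {j \<in> J. v j \<noteq> \<zero>\<^bsub>V j\<^esub>} \<union> {j \<in> J. w j \<noteq> \<zero>\<^bsub>V j\<^esub>}"
      using V by (auto simp: vspaceD)
    then have "finite {j \<in> J. (\<lambda>j\<in>J. v j \<oplus>\<^bsub>V j\<^esub> w j) j \<noteq> \<zero>\<^bsub>V j\<^esub>}"
      by (rule finite_subset) (use that in auto)
    then show ?thesis using that by (simp add: vspace_add_closed[OF V] mem)
  qed
  have smult: "c \<odot>\<^bsub>direct_sum_space J V\<^esub> v \<in> carrier (direct_sum_space J V)"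
    if "v \<in> carrier (direct_sum_space J V)" for c v
  proof -
    have "{j \<in> J. (\<lambda>j\<in>J. c \<odot>\<^bsub>V j\<^esub> v j) j \<noteq> \<zero>\<^bsub>V j\<^esub>} \<subseteq> {j \<in> J. v j \<noteq> \<zero>\<^bsub>V j\<^esub>}"
      using V by (auto simp: vspaceD)
    then have "finite {j \<in> J. (\<lambda>j\<in>J. c \<odot>\<^bsub>V j\<^esub> v j) j \<noteq> \<zero>\<^bsub>V j\<^esub>}"
      by (rule finite_subset) (use that in auto)
    then show ?thesis using that by (simp add: vspace_smult_closed[OF V] mem)
  qed
  have zero: "\<zero>\<^bsub>direct_sum_space J V\<^esub> \<in> carrier (direct_sum_space J V)"
  proof -
    have "{j \<in> J. (\<lambda>j\<in>J. \<zero>\<^bsub>V j\<^esub>) j \<noteq> \<zero>\<^bsub>V j\<^esub>} = {}" by auto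
    then show ?thesis by (simp add: vspace_zero_closed[OF V])
  qed
  have memS: "v j \<in> carrier (V j)" if "v \<in> carrier (direct_sum_space J V)" "j \<in> J" for v j
    using that by auto
  note [simp del] = direct_sum_space_sel(1)
  show ?thesis
  proof (rule vspaceI)
    fix v w assume "v \<in> carrier (direct_sum_space J V)" "w \<in> carrier (direct_sum_space J V)"
    then show "v \<oplus>\<^bsub>direct_sum_space J V\<^esub> w = w \<oplus>\<^bsub>direct_sum_space J V\<^esub> v"
      by (intro eqI add) (simp_all add: memS vspace_comm[OF V])
  next
    fix v assume v: "v \<in> carrier (direct_sum_space J V)"
    show "\<zero>\<^bsub>direct_sum_space J V\<^esub> \<oplus>\<^bsub>direct_sum_space J V\<^esub> v = v"
      using v by (intro eqI add zero) (simp_all add: memS V vspace_l_zero)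
    show "1 \<odot>\<^bsub>direct_sum_space J V\<^esub> v = v"
      using v by (intro eqI smult) (simp_all add: memS V vspace_smult_one)
    show "0 \<odot>\<^bsub>direct_sum_space J V\<^esub> v = \<zero>\<^bsub>direct_sum_space J V\<^esub>"
      using v by (intro eqI smult zero) (simp_all add: memS V vspace_smult_zero)
  qed ((erule (1) add | rule zero | erule smult)?; (rule ext)?; simp add: restrict_def memS V
      vspace_assoc vspace_distr_left vspace_distr_right vspace_smult_smult)+
qed

lemma vspace_free_space: "vspace (free_space X)"
  unfolding free_space_def by (rule vspace_direct_sum_space) (rule vspace_complex_alg)

lemma submodule_vspaceD:
  fixes V (structure)
  assumes "submodule N complex_alg V" "vspace V"
  shows "N \<subseteq> carrier V" "\<zero> \<in> N" "\<And>x y. x \<in> N \<Longrightarrow> y \<in> N \<Longrightarrow> x \<oplus> y \<in> N"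
    "\<And>c x. x \<in> N \<Longrightarrow> c \<odot> x \<in> N" "abelian_subgroup N V"
proof -
  interpret V: module complex_alg V by fact
  note E = V.submoduleE[OF assms(1)]
  show 1: "N \<subseteq> carrier V" "\<And>x y. x \<in> N \<Longrightarrow> y \<in> N \<Longrightarrow> x \<oplus> y \<in> N" by (use E in auto)
  show 2: "\<And>c x. x \<in> N \<Longrightarrow> c \<odot> x \<in> N" using E(4) by simp
  obtain x where x: "x \<in> N" using E(2) by auto
  then show "\<zero> \<in> N" using 1(1) 2[OF x, of 0] vspace_smult_zero[OF assms(2)] by auto
  show "abelian_subgroup N V"
    using assms(1) V.M.abelian_group_axioms
    by (intro abelian_subgroupI3) (auto simp: additive_subgroup_def submodule_def)
qed

lemma quotient_space_sel [simp]:
  "carrier (quotient_space V N) = a_rcosets\<^bsub>V\<^esub> N" "\<zero>\<^bsub>quotient_space V N\<^esub> = N"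
  "x \<oplus>\<^bsub>quotient_space V N\<^esub> y = x <+>\<^bsub>V\<^esub> y"
  "c \<odot>\<^bsub>quotient_space V N\<^esub> x = (\<Union>x\<in>x. N +>\<^bsub>V\<^esub> (c \<odot>\<^bsub>V\<^esub> x))"
  by (simp_all add: quotient_space_def)

lemma carrier_quotient_space: "carrier (quotient_space V N) = (\<lambda>x. N +>\<^bsub>V\<^esub> x) ` carrier V"
  by (auto simp: A_RCOSETS_def')

context
  fixes V :: "(complex, 'v, 'm) module_scheme" (structure) and N
  assumes V: "vspace V" and N: "submodule N complex_alg V"
begin

lemma coset_mem_iff: "x \<in> carrier V \<Longrightarrow> y \<in> N +> x \<longleftrightarrow> (\<exists>n\<in>N. y = n \<oplus> x)"
  by (auto simp: a_r_coset_def')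

lemma coset_add:
  assumes "x \<in> carrier V" "y \<in> carrier V"
  shows "(N +> x) <+> (N +> y) = N +> (x \<oplus> y)"
  by (rule abelian_subgroup.a_rcos_sum[OF submodule_vspaceD(5)[OF N V] assms])

lemma coset_absorb:
  assumes "n \<in> N" "x \<in> carrier V"
  shows "N +> (n \<oplus> x) = N +> x"
proof -
  interpret V: module complex_alg V by (rule V)
  show ?thesis
    using V.M.a_repr_independence[of "n \<oplus> x" N x] assms N
    by (auto simp: coset_mem_iff submodule_def)
qed

text \<open>Representatives of a coset differ by elements of \<open>N\<close>, and \<open>N\<close> is closed under scalar
  multiplication; all sets in the union are therefore the same coset.\<close>

lemma coset_smult:
  assumes x: "x \<in> carrier V"
  shows "(\<Union>y\<in>N +> x. N +> (c \<odot> y)) = N +> (c \<odot> x)"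
proof -
  note S = submodule_vspaceD[OF N V]
  have "N +> (c \<odot> y) = N +> (c \<odot> x)" if "y \<in> N +> x" for y
  proof -
    obtain n where n: "n \<in> N" "y = n \<oplus> x" using \<open>y \<in> N +> x\<close> x by (auto simp: coset_mem_iff)
    then have "c \<odot> y = (c \<odot> n) \<oplus> (c \<odot> x)" using x S(1) by (auto simp: vspaceD[OF V])
    then show ?thesis using n x S(4)[OF n(1)] by (simp add: coset_absorb vspaceD[OF V])
  qed
  moreover have "x \<in> N +> x" using x S(2) by (auto simp: coset_mem_iff vspaceD[OF V] intro!: bexI[of _ \<zero>])
  ultimately show ?thesis by blast
qed

lemma coset_zero: "N +> \<zero> = N"
  using submodule_vspaceD(1)[OF N V] by (auto simp: a_r_coset_def' vspaceD[OF V] subset_iff)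

lemma vspace_quotient_space: "vspace (quotient_space V N)"
proof (rule vspaceI, unfold carrier_quotient_space, goal_cases)
  case 4
  then show ?case using coset_zero vspace_zero_closed[OF V] by force
next
  case (5 x)
  then obtain y where y: "y \<in> carrier V" "x = N +> y" by auto
  then show ?case
    using coset_add[of \<zero> y] by (simp add: coset_zero vspaceD[OF V])
qed (elim imageE; simp add: coset_add coset_smult vspaceD[OF V] coset_zero)+

lemma linear_map_coset: "linear_map V (quotient_space V N) (\<lambda>x. N +> x)"
  by (rule linear_mapI) (auto simp: carrier_quotient_space coset_add coset_smult
      simp del: quotient_space_sel(1))

end

lemma submodule_carrier: "vspace V \<Longrightarrow> submodule (carrier V) complex_alg V"
  by (rule module.carrier_is_submodule)

lemma submodule_vspaceI:
  fixes V (structure)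
  assumes "vspace V" "N \<subseteq> carrier V" "\<zero> \<in> N" "\<And>x y. x \<in> N \<Longrightarrow> y \<in> N \<Longrightarrow> x \<oplus> y \<in> N"
    "\<And>c x. x \<in> N \<Longrightarrow> c \<odot> x \<in> N"
  shows "submodule N complex_alg V"
proof (rule module.submoduleI[OF assms(1)])
  fix x assume "x \<in> N"
  then have "(-1) \<odot> x \<in> N" "x \<in> carrier V" using assms by auto
  then show "\<ominus> x \<in> N" using assms(1) by (simp add: vspace_minus)
qed (use assms in auto)

lemma submodule_span_in:
  assumes V: "vspace V" and "B \<subseteq> carrier V"
  shows "submodule (span_in V B) complex_alg V"
proof (rule submodule_vspaceI[OF V])
  show "span_in V B \<subseteq> carrier V"
    using submodule_carrier[OF V] assms(2) by (auto simp: span_in_def)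
qed (auto simp: span_in_def dest: submodule_vspaceD[OF _ V])

lemma span_in_superset: "B \<subseteq> span_in V B"
  by (auto simp: span_in_def)

text \<open>The kernel of a linear map is a submodule, so it contains the span of any of its subsets.\<close>

lemma linear_map_vanishes_on_span:
  assumes f: "linear_map V W f" and V: "vspace V" and W: "vspace W" and B: "B \<subseteq> carrier V"
    and f0: "\<And>x. x \<in> B \<Longrightarrow> f x = \<zero>\<^bsub>W\<^esub>" and n: "n \<in> span_in V B"
  shows "f n = \<zero>\<^bsub>W\<^esub>"
proof -
  have "submodule {x \<in> carrier V. f x = \<zero>\<^bsub>W\<^esub>} complex_alg V"
    by (rule submodule_vspaceI[OF V])
      (auto simp: vspaceD[OF V] vspaceD[OF W] linear_mapD[OF f] linear_map_zero[OF f V W])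
  then show ?thesis using n B f0 by (auto simp: span_in_def)
qed

section \<open>Tensor products\<close>

definition bilinear_map ::
    "(complex, 'v, 'm) module_scheme \<Rightarrow> (complex, 'w, 'n) module_scheme
      \<Rightarrow> (complex, 'a, 'k) module_scheme \<Rightarrow> ('v \<Rightarrow> 'w \<Rightarrow> 'a) \<Rightarrow> bool" where
  "bilinear_map V W M B \<longleftrightarrow>
     (\<forall>w\<in>carrier W. linear_map V M (\<lambda>v. B v w)) \<and> (\<forall>v\<in>carrier V. linear_map W M (B v))"

lemma bilinear_mapI:
  "(\<And>w. w \<in> carrier W \<Longrightarrow> linear_map V M (\<lambda>v. B v w)) \<Longrightarrow>
   (\<And>v. v \<in> carrier V \<Longrightarrow> linear_map W M (\<lambda>w. B v w)) \<Longrightarrow> bilinear_map V W M B"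
  by (auto simp: bilinear_map_def)

lemma bilinear_mapD:
  assumes "bilinear_map V W M B"
  shows bilinear_map_left: "w \<in> carrier W \<Longrightarrow> linear_map V M (\<lambda>v. B v w)"
    and bilinear_map_right: "v \<in> carrier V \<Longrightarrow> linear_map W M (\<lambda>w. B v w)"
    and bilinear_map_closed: "v \<in> carrier V \<Longrightarrow> w \<in> carrier W \<Longrightarrow> B v w \<in> carrier M"
  using assms by (auto simp: bilinear_map_def linear_map_def)

lemma free_space_sel:
  "f \<in> carrier (free_space X) \<longleftrightarrow> f \<in> extensional X \<and> finite {x\<in>X. f x \<noteq> 0}"
  "f \<oplus>\<^bsub>free_space X\<^esub> g = (\<lambda>x\<in>X. f x + g x)"
  "c \<odot>\<^bsub>free_space X\<^esub> f = (\<lambda>x\<in>X. c * f x)"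
  by (auto simp: free_space_def PiE_def)

lemma free_basis_closed: "free_basis X x \<in> carrier (free_space X)"
proof -
  have "{y \<in> X. free_basis X x y \<noteq> 0} \<subseteq> {x}" by (auto simp: free_basis_def)
  then have "finite {y \<in> X. free_basis X x y \<noteq> 0}" by (rule finite_subset) simp
  then show ?thesis by (simp add: free_space_sel free_basis_def)
qed

text \<open>The linear extension of \<open>b\<close> from the basis to the free vector space.\<close>

definition free_lift :: "'x set \<Rightarrow> (complex, 'a, 'k) module_scheme \<Rightarrow> ('x \<Rightarrow> 'a) \<Rightarrow> ('x \<Rightarrow> complex) \<Rightarrow> 'a" where
  "free_lift X M b f = (\<Oplus>\<^bsub>M\<^esub>x\<in>{x\<in>X. f x \<noteq> 0}. f x \<odot>\<^bsub>M\<^esub> b x)"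

context
  fixes M :: "(complex, 'a, 'k) module_scheme" (structure) and X :: "'x set" and b
  assumes M: "vspace M" and b: "\<And>x. x \<in> X \<Longrightarrow> b x \<in> carrier M"
begin

text \<open>Summing over any finite set that contains the support makes the sums of two functions with
  different supports comparable.\<close>

lemma free_lift_superset:
  assumes "finite A" "A \<subseteq> X" "\<And>x. x \<in> X \<Longrightarrow> f x \<noteq> 0 \<Longrightarrow> x \<in> A"
  shows "free_lift X M b f = (\<Oplus>x\<in>A. f x \<odot> b x)"
proof -
  interpret M: module complex_alg M by (rule M)
  have "(\<Oplus>x\<in>A. f x \<odot> b x) = (\<Oplus>x\<in>{x\<in>X. f x \<noteq> 0}. f x \<odot> b x)"
  proof (rule M.add.finprod_mono_neutral_cong_right)
    show "finite A" "{x\<in>X. f x \<noteq> 0} \<subseteq> A" using assms by auto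
    show "\<And>x. x \<in> A - {x \<in> X. f x \<noteq> 0} \<Longrightarrow> f x \<odot> b x = \<zero>"
      using assms(2) b by (auto simp: vspace_smult_zero[OF M])
    show "(\<lambda>x. f x \<odot> b x) \<in> A \<rightarrow> carrier M"
      using assms(2) b by (auto simp: vspace_smult_closed[OF M])
  qed auto
  then show ?thesis by (simp add: free_lift_def)
qed

lemma linear_map_free_lift: "linear_map (free_space X) M (free_lift X M b)"
proof -
  interpret M: module complex_alg M by (rule M)
  show ?thesis
  proof (rule linear_mapI)
    fix f assume f: "f \<in> carrier (free_space X)"
    then show "free_lift X M b f \<in> carrier M"
      unfolding free_lift_def
      by (intro M.M.finsum_closed) (auto simp: vspace_smult_closed[OF M] b)
    fix c
    let ?A = "{x \<in> X. f x \<noteq> 0}"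
    have "free_lift X M b (c \<odot>\<^bsub>free_space X\<^esub> f) = (\<Oplus>x\<in>?A. (c \<odot>\<^bsub>free_space X\<^esub> f) x \<odot> b x)"
      by (rule free_lift_superset) (use f in \<open>auto simp: free_space_sel\<close>)
    also have "\<dots> = (\<Oplus>x\<in>?A. c \<odot> (f x \<odot> b x))"
      by (rule M.M.finsum_cong') (auto simp: vspaceD[OF M] b free_space_sel)
    also have "\<dots> = c \<odot> (\<Oplus>x\<in>?A. f x \<odot> b x)"
      by (rule M.finsum_smult_ldistr[symmetric])
        (use f in \<open>auto simp: free_space_sel vspaceD[OF M] b\<close>)
    finally show "free_lift X M b (c \<odot>\<^bsub>free_space X\<^esub> f) = c \<odot> free_lift X M b f"
      by (simp add: free_lift_def)
  next
    fix f g assume f: "f \<in> carrier (free_space X)" and g: "g \<in> carrier (free_space X)"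
    let ?A = "{x \<in> X. f x \<noteq> 0} \<union> {x \<in> X. g x \<noteq> 0}"
    have A: "finite ?A" using f g by (simp add: free_space_sel)
    have "free_lift X M b (f \<oplus>\<^bsub>free_space X\<^esub> g) = (\<Oplus>x\<in>?A. (f \<oplus>\<^bsub>free_space X\<^esub> g) x \<odot> b x)"
      by (rule free_lift_superset) (use A in \<open>auto simp: free_space_sel\<close>)
    also have "\<dots> = (\<Oplus>x\<in>?A. f x \<odot> b x \<oplus> g x \<odot> b x)"
      by (rule M.M.finsum_cong') (auto simp: vspaceD[OF M] b free_space_sel)
    also have "\<dots> = (\<Oplus>x\<in>?A. f x \<odot> b x) \<oplus> (\<Oplus>x\<in>?A. g x \<odot> b x)"
      by (rule M.M.finsum_addf) (auto simp: vspaceD[OF M] b)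
    also have "(\<Oplus>x\<in>?A. f x \<odot> b x) = free_lift X M b f"
      by (rule free_lift_superset[symmetric]) (use A in auto)
    also have "(\<Oplus>x\<in>?A. g x \<odot> b x) = free_lift X M b g"
      by (rule free_lift_superset[symmetric]) (use A in auto)
    finally show "free_lift X M b (f \<oplus>\<^bsub>free_space X\<^esub> g) = free_lift X M b f \<oplus> free_lift X M b g" .
  qed
qed

lemma free_lift_basis:
  assumes x: "x \<in> X"
  shows "free_lift X M b (free_basis X x) = b x"
proof -
  interpret M: module complex_alg M by (rule M)
  have "free_lift X M b (free_basis X x) = (\<Oplus>y\<in>{x}. free_basis X x y \<odot> b y)"
    by (rule free_lift_superset) (auto simp: free_basis_def x split: if_splits)
  also have "\<dots> = free_basis X x x \<odot> b x"
    using x by (subst M.M.finsum_insert) (auto simp: vspaceD[OF M] b)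
  finally show ?thesis using x by (simp add: free_basis_def vspaceD[OF M] b)
qed

end

text \<open>Clearing one coefficient at a time exhausts a finite support.\<close>

lemma free_space_generated:
  assumes "f \<in> carrier (free_space X)"
  shows "\<exists>xs. set xs \<subseteq> X \<and> f = list_sum (free_space X) (\<lambda>x. f x \<odot>\<^bsub>free_space X\<^esub> free_basis X x) xs"
proof -
  note F = vspaceD[OF vspace_free_space[of X]]
  have "\<exists>xs. set xs \<subseteq> A \<and>
      f = list_sum (free_space X) (\<lambda>x. f x \<odot>\<^bsub>free_space X\<^esub> free_basis X x) xs"
    if "finite A" "A \<subseteq> X" "f \<in> extensional X" "\<And>x. x \<in> X \<Longrightarrow> f x \<noteq> 0 \<Longrightarrow> x \<in> A" for A f
    using that
  proof (induction A arbitrary: f)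
    case empty
    then have "f = \<zero>\<^bsub>free_space X\<^esub>" by (auto simp: free_space_def fun_eq_iff extensional_def)
    then show ?case by (intro exI[of _ "[]"]) simp
  next
    case (insert a A)
    let ?g = "f(a := 0)"
    have "\<exists>xs. set xs \<subseteq> A \<and>
        ?g = list_sum (free_space X) (\<lambda>x. ?g x \<odot>\<^bsub>free_space X\<^esub> free_basis X x) xs"
      by (rule insert.IH) (use insert.prems in \<open>auto simp: extensional_def split: if_splits\<close>)
    then obtain xs where xs: "set xs \<subseteq> A"
      "?g = list_sum (free_space X) (\<lambda>x. ?g x \<odot>\<^bsub>free_space X\<^esub> free_basis X x) xs" by blast
    then have a: "a \<notin> set xs" using insert.hyps by auto
    have f: "f = f a \<odot>\<^bsub>free_space X\<^esub> free_basis X a \<oplus>\<^bsub>free_space X\<^esub> ?g"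
    proof
      fix x
      show "f x = (f a \<odot>\<^bsub>free_space X\<^esub> free_basis X a \<oplus>\<^bsub>free_space X\<^esub> ?g) x"
        using insert.prems(1,2) extensional_arb[of f X x]
        by (cases "x \<in> X"; cases "x = a") (simp_all add: free_space_sel free_basis_def)
    qed
    have g: "?g = list_sum (free_space X) (\<lambda>x. f x \<odot>\<^bsub>free_space X\<^esub> free_basis X x) xs"
      by (rule trans[OF xs(2) list_sum_cong[OF refl]]) (use a in auto)
    have "f = list_sum (free_space X) (\<lambda>x. f x \<odot>\<^bsub>free_space X\<^esub> free_basis X x) (a # xs)"
      unfolding list_sum.simps g[symmetric] by (rule f)
    moreover have "set (a # xs) \<subseteq> insert a A" using xs(1) by auto
    ultimately show ?case by blast
  qed
  from this[of "{x \<in> X. f x \<noteq> 0}" f] assms show ?thesis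
    by (auto simp: free_space_sel)
qed

context
  fixes V :: "(complex, 'v, 'm) module_scheme" and W :: "(complex, 'w, 'n) module_scheme"
  assumes V: "vspace V" and W: "vspace W"
begin

private abbreviation "VW \<equiv> carrier V \<times> carrier W"
private abbreviation "F \<equiv> free_space VW"
private abbreviation "N \<equiv> tensor_null V W"
private abbreviation "e v w \<equiv> free_basis VW (v, w)"

text \<open>The generators of the subspace that is divided out. As a definition of its own, the set lets
  a single relation be imposed without unfolding the span.\<close>

private definition "relations =
      {e (v \<oplus>\<^bsub>V\<^esub> v') w \<ominus>\<^bsub>F\<^esub> (e v w \<oplus>\<^bsub>F\<^esub> e v' w) | v v' w.
          v \<in> carrier V \<and> v' \<in> carrier V \<and> w \<in> carrier W} \<union>
       {e v (w \<oplus>\<^bsub>W\<^esub> w') \<ominus>\<^bsub>F\<^esub> (e v w \<oplus>\<^bsub>F\<^esub> e v w') | v w w'.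
          v \<in> carrier V \<and> w \<in> carrier W \<and> w' \<in> carrier W} \<union>
       {e (c \<odot>\<^bsub>V\<^esub> v) w \<ominus>\<^bsub>F\<^esub> (c \<odot>\<^bsub>F\<^esub> e v w) | c v w. v \<in> carrier V \<and> w \<in> carrier W} \<union>
       {e v (c \<odot>\<^bsub>W\<^esub> w) \<ominus>\<^bsub>F\<^esub> (c \<odot>\<^bsub>F\<^esub> e v w) | c v w. v \<in> carrier V \<and> w \<in> carrier W}"

lemma tensor_null_eq: "N = span_in F relations"
  by (simp add: tensor_null_def relations_def Let_def)

lemma free_space_diff_closed: "x \<in> carrier F \<Longrightarrow> y \<in> carrier F \<Longrightarrow> x \<ominus>\<^bsub>F\<^esub> y \<in> carrier F"
  by (simp add: a_minus_def vspaceD[OF vspace_free_space] del: free_space_sel)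

lemma relations_closed: "relations \<subseteq> carrier F"
  unfolding relations_def
  by (auto intro!: free_space_diff_closed vspace_add_closed vspace_smult_closed vspace_free_space free_basis_closed)

lemma submodule_tensor_null: "submodule N complex_alg F"
  unfolding tensor_null_eq by (rule submodule_span_in[OF vspace_free_space relations_closed])

lemma vspace_tensor_space: "vspace (tensor_space V W)"
  unfolding tensor_space_def by (rule vspace_quotient_space[OF vspace_free_space submodule_tensor_null])

lemma linear_map_tensor_coset: "linear_map F (tensor_space V W) (\<lambda>f. N +>\<^bsub>F\<^esub> f)"
  unfolding tensor_space_def by (rule linear_map_coset[OF vspace_free_space submodule_tensor_null])

lemma carrier_tensor_space: "carrier (tensor_space V W) = (\<lambda>f. N +>\<^bsub>F\<^esub> f) ` carrier F"
  unfolding tensor_space_def by (rule carrier_quotient_space)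

lemma relation_coset_eq:
  assumes "x \<ominus>\<^bsub>F\<^esub> y \<in> relations" "x \<in> carrier F" "y \<in> carrier F"
  shows "N +>\<^bsub>F\<^esub> x = N +>\<^bsub>F\<^esub> y"
proof -
  interpret F: module complex_alg F by (rule vspace_free_space)
  have "x \<ominus>\<^bsub>F\<^esub> y \<in> N" using assms(1) span_in_superset[of relations F] by (auto simp: tensor_null_eq)
  then have "N +>\<^bsub>F\<^esub> ((x \<ominus>\<^bsub>F\<^esub> y) \<oplus>\<^bsub>F\<^esub> y) = N +>\<^bsub>F\<^esub> y"
    by (rule coset_absorb[OF vspace_free_space submodule_tensor_null _ assms(3)])
  moreover have "(x \<ominus>\<^bsub>F\<^esub> y) \<oplus>\<^bsub>F\<^esub> y = x"
    using assms(2,3) by (simp add: a_minus_def F.M.a_assoc F.M.l_neg)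
  ultimately show ?thesis by simp
qed

text \<open>Each of the four families of relations expresses one of the four bilinearity laws.\<close>

lemma bilinear_map_pure_tensor: "bilinear_map V W (tensor_space V W) (pure_tensor V W)"
proof -
  note L = linear_map_tensor_coset
  note [simp] = free_basis_closed vspace_add_closed[OF vspace_free_space]
    vspace_smult_closed[OF vspace_free_space]
  have rel: "e (v \<oplus>\<^bsub>V\<^esub> v') w \<ominus>\<^bsub>F\<^esub> (e v w \<oplus>\<^bsub>F\<^esub> e v' w) \<in> relations"
      "e v (w \<oplus>\<^bsub>W\<^esub> w') \<ominus>\<^bsub>F\<^esub> (e v w \<oplus>\<^bsub>F\<^esub> e v w') \<in> relations"
      "e (c \<odot>\<^bsub>V\<^esub> v) w \<ominus>\<^bsub>F\<^esub> (c \<odot>\<^bsub>F\<^esub> e v w) \<in> relations"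
      "e v (c \<odot>\<^bsub>W\<^esub> w) \<ominus>\<^bsub>F\<^esub> (c \<odot>\<^bsub>F\<^esub> e v w) \<in> relations"
    if "v \<in> carrier V" "v' \<in> carrier V" "w \<in> carrier W" "w' \<in> carrier W" for v v' w w' c
    unfolding relations_def using that by blast+
  have eqs: "N +>\<^bsub>F\<^esub> e (v \<oplus>\<^bsub>V\<^esub> v') w = N +>\<^bsub>F\<^esub> (e v w \<oplus>\<^bsub>F\<^esub> e v' w)"
      "N +>\<^bsub>F\<^esub> e v (w \<oplus>\<^bsub>W\<^esub> w') = N +>\<^bsub>F\<^esub> (e v w \<oplus>\<^bsub>F\<^esub> e v w')"
      "N +>\<^bsub>F\<^esub> e (c \<odot>\<^bsub>V\<^esub> v) w = N +>\<^bsub>F\<^esub> (c \<odot>\<^bsub>F\<^esub> e v w)"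
      "N +>\<^bsub>F\<^esub> e v (c \<odot>\<^bsub>W\<^esub> w) = N +>\<^bsub>F\<^esub> (c \<odot>\<^bsub>F\<^esub> e v w)"
    if "v \<in> carrier V" "v' \<in> carrier V" "w \<in> carrier W" "w' \<in> carrier W" for v v' w w' c
    by (rule relation_coset_eq, rule rel; use that in simp)+
  show ?thesis
    by (intro bilinear_mapI linear_mapI; unfold pure_tensor_def)
      (simp_all add: eqs linear_map_add[OF L] linear_map_smult[OF L] linear_map_closed[OF L])
qed

text \<open>The coefficients of the formal linear combination can be moved into the first factors.\<close>

lemma tensor_generated:
  assumes "t \<in> carrier (tensor_space V W)"
  shows "\<exists>ps. set ps \<subseteq> carrier V \<times> carrier W \<and>
    t = list_sum (tensor_space V W) (\<lambda>(v, w). pure_tensor V W v w) ps"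
proof -
  note L = linear_map_tensor_coset
  obtain f where f: "f \<in> carrier F" "t = N +>\<^bsub>F\<^esub> f" using assms by (auto simp: carrier_tensor_space)
  obtain xs where xs: "set xs \<subseteq> VW"
      "f = list_sum F (\<lambda>x. f x \<odot>\<^bsub>F\<^esub> free_basis VW x) xs"
    using free_space_generated[OF f(1)] by blast
  define ps where "ps = map (\<lambda>(v, w). (f (v, w) \<odot>\<^bsub>V\<^esub> v, w)) xs"
  have map: "list_sum M g (map h ys) = list_sum M (\<lambda>y. g (h y)) ys" for M g h ys
    by (induction ys) auto
  have "t = list_sum (tensor_space V W) (\<lambda>x. N +>\<^bsub>F\<^esub> (f x \<odot>\<^bsub>F\<^esub> free_basis VW x)) xs"
    unfolding f(2)
    by (subst xs(2), rule linear_map_list_sum[OF L vspace_free_space vspace_tensor_space])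
      (auto intro!: vspace_smult_closed vspace_free_space free_basis_closed)
  also have "\<dots> = list_sum (tensor_space V W) (\<lambda>(v, w). pure_tensor V W v w) ps"
    unfolding ps_def map
  proof (rule list_sum_cong[OF refl], clarify)
    fix v w assume "(v, w) \<in> set xs"
    then have vw: "v \<in> carrier V" "w \<in> carrier W" using xs(1) by auto
    have "pure_tensor V W (f (v, w) \<odot>\<^bsub>V\<^esub> v) w = f (v, w) \<odot>\<^bsub>tensor_space V W\<^esub> pure_tensor V W v w"
      using linear_map_smult[OF bilinear_map_left[OF bilinear_map_pure_tensor vw(2)] vw(1)] .
    then show "N +>\<^bsub>F\<^esub> (f (v, w) \<odot>\<^bsub>F\<^esub> e v w) = pure_tensor V W (f (v, w) \<odot>\<^bsub>V\<^esub> v) w"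
      by (simp add: pure_tensor_def linear_map_smult[OF L] free_basis_closed)
  qed
  finally show ?thesis
    using xs(1) by (intro exI[of _ ps]) (auto simp: ps_def vspaceD[OF V])
qed

context
  fixes M :: "(complex, 'a, 'k) module_scheme" and B
  assumes M: "vspace M" and B: "bilinear_map V W M B"
begin

private abbreviation "L \<equiv> free_lift VW M (\<lambda>p. B (fst p) (snd p))"

lemma linear_map_bilinear_extension: "linear_map F M L"
  by (rule linear_map_free_lift[OF M]) (use bilinear_map_closed[OF B] in auto)

lemma bilinear_extension_basis: "v \<in> carrier V \<Longrightarrow> w \<in> carrier W \<Longrightarrow> L (e v w) = B v w"
  by (subst free_lift_basis[OF M]) (use bilinear_map_closed[OF B] in auto)

lemma bilinear_extension_null:
  assumes "n \<in> N"
  shows "L n = \<zero>\<^bsub>M\<^esub>"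
proof (rule linear_map_vanishes_on_span[OF linear_map_bilinear_extension vspace_free_space M relations_closed])
  show "n \<in> span_in F relations" using assms by (simp add: tensor_null_eq)
  fix x assume x: "x \<in> relations"
  note [simp] = free_basis_closed vspace_add_closed[OF vspace_free_space]
    vspace_smult_closed[OF vspace_free_space] linear_map_diff[OF linear_map_bilinear_extension vspace_free_space M]
    linear_mapD[OF linear_map_bilinear_extension] bilinear_extension_basis vspace_add_closed[OF V] vspace_smult_closed[OF V]
    vspace_add_closed[OF W] vspace_smult_closed[OF W]
    linear_map_add[OF bilinear_map_left[OF B]] linear_map_smult[OF bilinear_map_left[OF B]]
    linear_map_add[OF bilinear_map_right[OF B]] linear_map_smult[OF bilinear_map_right[OF B]]
    bilinear_map_closed[OF B] vspace_add_closed[OF M] vspace_smult_closed[OF M] vspace_diff_eq_zero[OF M]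
  from x show "L x = \<zero>\<^bsub>M\<^esub>" unfolding relations_def by (elim UnE CollectE exE conjE; simp)
qed

text \<open>Bilinearity of \<open>B\<close> makes its linear extension vanish on the relations, hence constant on
  cosets, and \<^const>\<open>the_elem\<close> is then applied to a singleton.\<close>

lemma tensor_lift_coset:
  assumes f: "f \<in> carrier F"
  shows "tensor_lift V W M B (N +>\<^bsub>F\<^esub> f) = L f"
proof -
  note S = submodule_vspaceD[OF submodule_tensor_null vspace_free_space]
  have "L g = L f" if g: "g \<in> N +>\<^bsub>F\<^esub> f" for g
  proof -
    obtain n where n: "n \<in> N" "g = n \<oplus>\<^bsub>F\<^esub> f"
      using g coset_mem_iff[OF vspace_free_space submodule_tensor_null f] by blast
    then have "L g = L n \<oplus>\<^bsub>M\<^esub> L f" using f S(1) by (auto intro: linear_map_add[OF linear_map_bilinear_extension])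
    then show ?thesis
      using bilinear_extension_null[OF n(1)] f by (simp add: vspaceD[OF M] linear_map_closed[OF linear_map_bilinear_extension])
  qed
  moreover have "f \<in> N +>\<^bsub>F\<^esub> f"
    by (rule abelian_subgroup.a_rcos_self[OF S(5) f])
  ultimately have "L ` (N +>\<^bsub>F\<^esub> f) = {L f}" by blast
  then show ?thesis by (simp add: tensor_lift_def free_lift_def)
qed

lemma tensor_lift_pure:
  "v \<in> carrier V \<Longrightarrow> w \<in> carrier W \<Longrightarrow> tensor_lift V W M B (pure_tensor V W v w) = B v w"
  by (simp add: pure_tensor_def tensor_lift_coset free_basis_closed bilinear_extension_basis)

lemma linear_map_tensor_lift: "linear_map (tensor_space V W) M (tensor_lift V W M B)"
proof (rule linear_mapI)
  note C = linear_map_add[OF linear_map_tensor_coset, symmetric]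
    linear_map_smult[OF linear_map_tensor_coset, symmetric]
  note LD = linear_mapD[OF linear_map_bilinear_extension]
  note FD = vspace_add_closed[OF vspace_free_space] vspace_smult_closed[OF vspace_free_space]
  fix s c assume "s \<in> carrier (tensor_space V W)"
  then obtain f where f: "f \<in> carrier F" "s = N +>\<^bsub>F\<^esub> f" by (auto simp: carrier_tensor_space)
  then show "tensor_lift V W M B s \<in> carrier M" by (simp add: tensor_lift_coset LD(1))
  show "tensor_lift V W M B (c \<odot>\<^bsub>tensor_space V W\<^esub> s) = c \<odot>\<^bsub>M\<^esub> tensor_lift V W M B s"
    using f by (simp add: tensor_lift_coset C FD LD)
  fix t assume "t \<in> carrier (tensor_space V W)"
  then obtain g where g: "g \<in> carrier F" "t = N +>\<^bsub>F\<^esub> g" by (auto simp: carrier_tensor_space)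
  then show "tensor_lift V W M B (s \<oplus>\<^bsub>tensor_space V W\<^esub> t)
      = tensor_lift V W M B s \<oplus>\<^bsub>M\<^esub> tensor_lift V W M B t"
    using f by (simp add: tensor_lift_coset C FD LD)
qed

lemma tensor_lift_list_sum:
  assumes "set ps \<subseteq> carrier V \<times> carrier W"
  shows "tensor_lift V W M B (list_sum (tensor_space V W) (\<lambda>(v, w). pure_tensor V W v w) ps)
    = list_sum M (\<lambda>(v, w). B v w) ps"
proof -
  have "tensor_lift V W M B (list_sum (tensor_space V W) (\<lambda>(v, w). pure_tensor V W v w) ps)
      = list_sum M (\<lambda>p. tensor_lift V W M B (case p of (v, w) \<Rightarrow> pure_tensor V W v w)) ps"
    by (rule linear_map_list_sum[OF linear_map_tensor_lift vspace_tensor_space M])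
      (use assms bilinear_map_closed[OF bilinear_map_pure_tensor] in auto)
  also have "\<dots> = list_sum M (\<lambda>(v, w). B v w) ps"
    by (rule list_sum_cong) (use assms in \<open>auto simp: tensor_lift_pure\<close>)
  finally show ?thesis .
qed

end

end

lemma bilinear_map_cong:
  assumes "bilinear_map V W M B" "vspace V" "vspace W"
    and "\<And>v w. v \<in> carrier V \<Longrightarrow> w \<in> carrier W \<Longrightarrow> B v w = B' v w"
  shows "bilinear_map V W M B'"
proof (rule bilinear_mapI)
  show "linear_map V M (\<lambda>v. B' v w)" if "w \<in> carrier W" for w
    by (rule linear_map_cong[OF bilinear_map_left[OF assms(1) that] _ assms(2)]) (simp add: assms(4) that)
  show "linear_map W M (\<lambda>w. B' v w)" if "v \<in> carrier V" for v
    by (rule linear_map_cong[OF bilinear_map_right[OF assms(1) that] _ assms(3)]) (simp add: assms(4) that)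
qed

lemma bilinear_map_comp:
  assumes B: "bilinear_map V W M B" and f: "linear_map V' V f" and g: "linear_map W' W g"
  shows "bilinear_map V' W' M (\<lambda>x y. B (f x) (g y))"
proof (rule bilinear_mapI)
  fix w assume "w \<in> carrier W'"
  then show "linear_map V' M (\<lambda>v. B (f v) (g w))"
    by (intro linear_map_comp[OF bilinear_map_left[OF B] f] linear_map_closed[OF g])
next
  fix v assume "v \<in> carrier V'"
  then show "linear_map W' M (\<lambda>w. B (f v) (g w))"
    by (intro linear_map_comp[OF bilinear_map_right[OF B] g] linear_map_closed[OF f])
qed

text \<open>For linearity in a parameter of the bilinear map, the tensor \<open>t\<close> is fixed as a sum of pure
  tensors. The lift is then a sum of values of \<open>B\<close>, each of them linear in the parameter.\<close>

lemma linear_map_tensor_lift_fun: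
  assumes U: "vspace U" and V: "vspace V" and W: "vspace W" and M: "vspace M"
    and B: "\<And>u. u \<in> carrier U \<Longrightarrow> bilinear_map V W M (B u)"
    and l: "\<And>v w. v \<in> carrier V \<Longrightarrow> w \<in> carrier W \<Longrightarrow> linear_map U M (\<lambda>u. B u v w)"
    and t: "t \<in> carrier (tensor_space V W)"
  shows "linear_map U M (\<lambda>u. tensor_lift V W M (B u) t)"
proof -
  obtain ps where ps: "set ps \<subseteq> carrier V \<times> carrier W"
    "t = list_sum (tensor_space V W) (\<lambda>(v, w). pure_tensor V W v w) ps"
    using tensor_generated[OF V W t] by blast
  have "linear_map U M (\<lambda>u. list_sum M (\<lambda>(v, w). B u v w) ps)"
    by (rule linear_map_list_sum_fun[OF U M]) (use ps(1) in \<open>auto intro: l\<close>)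
  then show ?thesis
    by (rule linear_map_cong[OF _ _ U])
      (simp add: ps(2) tensor_lift_list_sum[OF V W M B ps(1)])
qed

section \<open>Sweedler sums\<close>

text \<open>Sweedler notation is made literal: a list of pairs \<open>(x, y)\<close> whose pure tensors sum up to the
  coproduct of \<open>a\<close> is chosen once and for all.\<close>

definition coproduct_terms :: "('h, 'm) hopf_star_scheme \<Rightarrow> 'h \<Rightarrow> ('h \<times> 'h) list" where
  "coproduct_terms H a = (SOME ps. set ps \<subseteq> carrier H \<times> carrier H \<and>
     comult H a = list_sum (tensor_space H H) (\<lambda>(x, y). pure_tensor H H x y) ps)"

text \<open>The sum of \<open>B a\<^sub>(\<^sub>1\<^sub>) a\<^sub>(\<^sub>2\<^sub>)\<close>. It is independent of the chosen list when \<open>B\<close> is bilinear.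
  As a plain finite sum it commutes with linear maps and with other such sums for every \<open>B\<close>, so
  bilinearity has to be checked only where an axiom on the coproduct is applied.\<close>

definition sweedler ::
    "('h, 'm) hopf_star_scheme \<Rightarrow> (complex, 'a, 'k) module_scheme \<Rightarrow> ('h \<Rightarrow> 'h \<Rightarrow> 'a) \<Rightarrow> 'h \<Rightarrow> 'a" where
  "sweedler H M B a = list_sum M (\<lambda>(x, y). B x y) (coproduct_terms H a)"

context hopf_algebra
begin

lemma vspace_H: "vspace H"
  by unfold_locales

text \<open>The locale inherits the ring laws twice, for \<open>H\<close> and for the ground field, and their plain
  names refer to the latter. The laws of \<open>H\<close> get names of their own here.\<close>

lemma ring_H_simps:
  shows mult_closed: "a \<in> carrier H \<Longrightarrow> b \<in> carrier H \<Longrightarrow> a \<otimes> b \<in> carrier H"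
    and unit_closed: "\<one> \<in> carrier H"
    and mult_assoc: "a \<in> carrier H \<Longrightarrow> b \<in> carrier H \<Longrightarrow> c \<in> carrier H \<Longrightarrow> (a \<otimes> b) \<otimes> c = a \<otimes> (b \<otimes> c)"
    and mult_unit_left: "a \<in> carrier H \<Longrightarrow> \<one> \<otimes> a = a"
    and mult_unit_right: "a \<in> carrier H \<Longrightarrow> a \<otimes> \<one> = a"
    and mult_distrib_right: "a \<in> carrier H \<Longrightarrow> b \<in> carrier H \<Longrightarrow> c \<in> carrier H \<Longrightarrow> (a \<oplus> b) \<otimes> c = (a \<otimes> c) \<oplus> (b \<otimes> c)"
    and mult_distrib_left: "a \<in> carrier H \<Longrightarrow> b \<in> carrier H \<Longrightarrow> c \<in> carrier H \<Longrightarrow> c \<otimes> (a \<oplus> b) = (c \<otimes> a) \<oplus> (c \<otimes> b)"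
proof -
  have "ring H" by unfold_locales
  note R = ringE[OF this]
  show "a \<in> carrier H \<Longrightarrow> b \<in> carrier H \<Longrightarrow> a \<otimes> b \<in> carrier H" "\<one> \<in> carrier H"
    "a \<in> carrier H \<Longrightarrow> b \<in> carrier H \<Longrightarrow> c \<in> carrier H \<Longrightarrow> (a \<otimes> b) \<otimes> c = a \<otimes> (b \<otimes> c)"
    "a \<in> carrier H \<Longrightarrow> \<one> \<otimes> a = a" "a \<in> carrier H \<Longrightarrow> a \<otimes> \<one> = a"
    "a \<in> carrier H \<Longrightarrow> b \<in> carrier H \<Longrightarrow> c \<in> carrier H \<Longrightarrow> (a \<oplus> b) \<otimes> c = (a \<otimes> c) \<oplus> (b \<otimes> c)"
    "a \<in> carrier H \<Longrightarrow> b \<in> carrier H \<Longrightarrow> c \<in> carrier H \<Longrightarrow> c \<otimes> (a \<oplus> b) = (c \<otimes> a) \<oplus> (c \<otimes> b)"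
    by (simp_all add: monoid.m_closed[OF R(2)] monoid.one_closed[OF R(2)] monoid.m_assoc[OF R(2)]
        monoid.l_one[OF R(2)] monoid.r_one[OF R(2)] R(3,4))
qed

lemma vspace_HH: "vspace (tensor_space H H)"
  by (rule vspace_tensor_space[OF vspace_H vspace_H])

lemma coproduct_terms:
  assumes "a \<in> carrier H"
  shows "set (coproduct_terms H a) \<subseteq> carrier H \<times> carrier H"
    and "comult H a = list_sum (tensor_space H H) (\<lambda>(x, y). pure_tensor H H x y) (coproduct_terms H a)"
proof -
  have "\<exists>ps. set ps \<subseteq> carrier H \<times> carrier H \<and>
      comult H a = list_sum (tensor_space H H) (\<lambda>(x, y). pure_tensor H H x y) ps"
    by (rule tensor_generated[OF vspace_H vspace_H linear_map_closed[OF comult_linear assms]])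
  from someI_ex[OF this]
  show "set (coproduct_terms H a) \<subseteq> carrier H \<times> carrier H"
    "comult H a = list_sum (tensor_space H H) (\<lambda>(x, y). pure_tensor H H x y) (coproduct_terms H a)"
    by (auto simp: coproduct_terms_def)
qed

lemma tensor_lift_comult:
  assumes "vspace M" "bilinear_map H H M B" "a \<in> carrier H"
  shows "tensor_lift H H M B (comult H a) = sweedler H M B a"
  unfolding coproduct_terms(2)[OF assms(3)] sweedler_def
  by (rule tensor_lift_list_sum[OF vspace_H vspace_H assms(1,2) coproduct_terms(1)[OF assms(3)]])

lemma sweedler_closed:
  assumes "vspace M" "a \<in> carrier H" "\<And>x y. x \<in> carrier H \<Longrightarrow> y \<in> carrier H \<Longrightarrow> B x y \<in> carrier M"
  shows "sweedler H M B a \<in> carrier M"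
  unfolding sweedler_def using coproduct_terms(1)[OF assms(2)] assms(3)
  by (auto intro!: list_sum_closed assms(1))

lemma sweedler_cong:
  assumes "a \<in> carrier H" "\<And>x y. x \<in> carrier H \<Longrightarrow> y \<in> carrier H \<Longrightarrow> B x y = B' x y"
  shows "sweedler H M B a = sweedler H M B' a"
  unfolding sweedler_def using coproduct_terms(1)[OF assms(1)] assms(2)
  by (auto intro!: list_sum_cong)

lemma linear_map_sweedler:
  assumes "linear_map M N h" "vspace M" "vspace N" "a \<in> carrier H"
    and "\<And>x y. x \<in> carrier H \<Longrightarrow> y \<in> carrier H \<Longrightarrow> B x y \<in> carrier M"
  shows "h (sweedler H M B a) = sweedler H N (\<lambda>x y. h (B x y)) a"
proof -
  have "h (sweedler H M B a) = list_sum N (\<lambda>p. h (case p of (x, y) \<Rightarrow> B x y)) (coproduct_terms H a)"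
    unfolding sweedler_def
    by (rule linear_map_list_sum[OF assms(1-3)]) (use coproduct_terms(1)[OF assms(4)] assms(5) in auto)
  also have "(\<lambda>p. h (case p of (x, y) \<Rightarrow> B x y)) = (\<lambda>(x, y). h (B x y))" by auto
  finally show ?thesis by (simp add: sweedler_def)
qed

lemma sweedler_swap:
  assumes "vspace M" "a \<in> carrier H" "b \<in> carrier H"
    and "\<And>x y u v. x \<in> carrier H \<Longrightarrow> y \<in> carrier H \<Longrightarrow> u \<in> carrier H \<Longrightarrow> v \<in> carrier H \<Longrightarrow>
      B x y u v \<in> carrier M"
  shows "sweedler H M (\<lambda>x y. sweedler H M (\<lambda>u v. B x y u v) b) a
    = sweedler H M (\<lambda>u v. sweedler H M (\<lambda>x y. B x y u v) a) b"
  using list_sum_swap[OF assms(1), of "coproduct_terms H a" "coproduct_terms H b"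
      "\<lambda>p q. B (fst p) (snd p) (fst q) (snd q)"]
    coproduct_terms(1)[OF assms(2)] coproduct_terms(1)[OF assms(3)] assms(4)
  by (auto simp: sweedler_def split_def subset_iff mem_Times_iff)

lemma linear_map_sweedler_fun:
  assumes "vspace V" "vspace M" "a \<in> carrier H"
    and "\<And>x y. x \<in> carrier H \<Longrightarrow> y \<in> carrier H \<Longrightarrow> linear_map V M (\<lambda>v. B v x y)"
  shows "linear_map V M (\<lambda>v. sweedler H M (\<lambda>x y. B v x y) a)"
  unfolding sweedler_def
  by (rule linear_map_list_sum_fun[OF assms(1,2)]) (use coproduct_terms(1)[OF assms(3)] assms(4) in auto)

lemma linear_map_mult_right: "linear_map V H f \<Longrightarrow> c \<in> carrier H \<Longrightarrow> linear_map V H (\<lambda>x. f x \<otimes> c)"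
  by (rule linear_mapI) (auto simp: linear_mapD mult_closed mult_distrib_right smult_mult_left)

lemma linear_map_mult_left: "linear_map V H f \<Longrightarrow> c \<in> carrier H \<Longrightarrow> linear_map V H (\<lambda>x. c \<otimes> f x)"
  by (rule linear_mapI) (auto simp: linear_mapD mult_closed mult_distrib_left smult_mult_right)

lemma linear_map_antipode: "linear_map V H f \<Longrightarrow> linear_map V H (\<lambda>x. antipode H (f x))"
  by (rule linear_map_comp[OF antipode_linear])

lemma linear_map_counit_smult:
  "linear_map V H f \<Longrightarrow> c \<in> carrier H \<Longrightarrow> linear_map V H (\<lambda>x. counit H (f x) \<odot> c)"
  by (rule linear_map_smult_fun[OF linear_map_comp[OF counit_linear] vspace_H])

lemmas linear_intros = linear_map_id linear_map_mult_right linear_map_mult_left linear_map_antipode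
  linear_map_counit_smult linear_map_smult_const[OF _ vspace_H]

lemma closed_simps [simp]:
  "\<one> \<in> carrier H" "a \<in> carrier H \<Longrightarrow> b \<in> carrier H \<Longrightarrow> a \<otimes> b \<in> carrier H"
  "a \<in> carrier H \<Longrightarrow> antipode H a \<in> carrier H" "a \<in> carrier H \<Longrightarrow> c \<odot> a \<in> carrier H"
  by (auto intro: linear_map_closed[OF antipode_linear] vspace_smult_closed[OF vspace_H] ring_H_simps(1,2))

lemma sweedler_closed_H [simp]:
  "a \<in> carrier H \<Longrightarrow> (\<And>x y. x \<in> carrier H \<Longrightarrow> y \<in> carrier H \<Longrightarrow> B x y \<in> carrier H) \<Longrightarrow>
    sweedler H H B a \<in> carrier H"
  by (rule sweedler_closed[OF vspace_H])

lemma sweedler_pull: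
  assumes "a \<in> carrier H" "\<And>x y. x \<in> carrier H \<Longrightarrow> y \<in> carrier H \<Longrightarrow> B x y \<in> carrier H"
  shows sweedler_mult_left:
      "c \<in> carrier H \<Longrightarrow> sweedler H H (\<lambda>x y. c \<otimes> B x y) a = c \<otimes> sweedler H H B a"
    and sweedler_mult_right:
      "c \<in> carrier H \<Longrightarrow> sweedler H H (\<lambda>x y. B x y \<otimes> c) a = sweedler H H B a \<otimes> c"
    and sweedler_smult: "sweedler H H (\<lambda>x y. k \<odot> B x y) a = k \<odot> sweedler H H B a"
    and sweedler_antipode: "sweedler H H (\<lambda>x y. antipode H (B x y)) a = antipode H (sweedler H H B a)"
  by (subst linear_map_sweedler[OF _ vspace_H vspace_H];
      (rule linear_intros linear_map_id refl | use assms in simp)+)+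

lemma sweedler_one:
  assumes "vspace M" "bilinear_map H H M B"
  shows "sweedler H M B \<one> = B \<one> \<one>"
proof -
  have "comult H \<one> = pure_tensor H H \<one> \<one>"
    using ring_hom_one[OF comult_hom] by (simp add: tensor_alg_def)
  then show ?thesis
    using tensor_lift_comult[OF assms unit_closed] tensor_lift_pure[OF vspace_H vspace_H assms unit_closed unit_closed]
    by simp
qed

text \<open>This is the multiplicativity of the coproduct, evaluated at a bilinear map.\<close>

lemma sweedler_mult:
  assumes M: "vspace M" and B: "bilinear_map H H M B" and a: "a \<in> carrier H" and b: "b \<in> carrier H"
  shows "sweedler H M B (a \<otimes> b)
    = sweedler H M (\<lambda>x y. sweedler H M (\<lambda>u v. B (x \<otimes> u) (y \<otimes> v)) b) a"
proof -
  let ?T = "tensor_space H H"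
  note P = bilinear_map_pure_tensor[OF vspace_H vspace_H]
  note L = linear_map_tensor_lift[OF vspace_H vspace_H M B]
  have inner: "tensor_lift H H ?T (\<lambda>u v. pure_tensor H H (x \<otimes> u) (y \<otimes> v)) (comult H b)
      = sweedler H ?T (\<lambda>u v. pure_tensor H H (x \<otimes> u) (y \<otimes> v)) b"
    if "x \<in> carrier H" "y \<in> carrier H" for x y
    by (intro tensor_lift_comult vspace_HH bilinear_map_comp[OF P] linear_intros b that)
  have lin: "bilinear_map H H ?T (\<lambda>x y. sweedler H ?T (\<lambda>u v. pure_tensor H H (x \<otimes> u) (y \<otimes> v)) b)"
  proof (intro bilinear_mapI linear_map_sweedler_fun vspace_H vspace_HH b)
    fix x y z assume "x \<in> carrier H" "y \<in> carrier H" "z \<in> carrier H"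
    then show "linear_map H ?T (\<lambda>v. pure_tensor H H (v \<otimes> x) (z \<otimes> y))"
      "linear_map H ?T (\<lambda>v. pure_tensor H H (z \<otimes> x) (v \<otimes> y))"
      by (auto intro!: linear_map_comp[OF bilinear_map_left[OF P]] linear_map_comp[OF bilinear_map_right[OF P]]
          linear_intros)
  qed
  have "comult H (a \<otimes> b) = tensor_lift H H ?T
      (\<lambda>x y. tensor_lift H H ?T (\<lambda>u v. pure_tensor H H (x \<otimes> u) (y \<otimes> v)) (comult H b)) (comult H a)"
    using ring_hom_mult[OF comult_hom a b] by (simp add: tensor_alg_def)
  also have "\<dots> = sweedler H ?T
      (\<lambda>x y. tensor_lift H H ?T (\<lambda>u v. pure_tensor H H (x \<otimes> u) (y \<otimes> v)) (comult H b)) a"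
    by (rule tensor_lift_comult[OF vspace_HH bilinear_map_cong[OF lin vspace_H vspace_H] a])
      (simp add: inner)
  also have "\<dots> = sweedler H ?T (\<lambda>x y. sweedler H ?T (\<lambda>u v. pure_tensor H H (x \<otimes> u) (y \<otimes> v)) b) a"
    by (rule sweedler_cong[OF a inner])
  finally have eq: "comult H (a \<otimes> b) = \<dots>" .
  have "sweedler H M B (a \<otimes> b) = tensor_lift H H M B (comult H (a \<otimes> b))"
    by (rule tensor_lift_comult[OF M B, symmetric]) (use a b in simp)
  also have "\<dots> = sweedler H M (\<lambda>x y. tensor_lift H H M B
      (sweedler H ?T (\<lambda>u v. pure_tensor H H (x \<otimes> u) (y \<otimes> v)) b)) a"
    unfolding eq by (rule linear_map_sweedler[OF L vspace_HH M a])
      (auto intro: bilinear_map_closed[OF lin])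
  also have "\<dots> = sweedler H M (\<lambda>x y. sweedler H M (\<lambda>u v. B (x \<otimes> u) (y \<otimes> v)) b) a"
  proof (rule sweedler_cong[OF a])
    fix x y assume xy: "x \<in> carrier H" "y \<in> carrier H"
    have "tensor_lift H H M B (sweedler H ?T (\<lambda>u v. pure_tensor H H (x \<otimes> u) (y \<otimes> v)) b)
        = sweedler H M (\<lambda>u v. tensor_lift H H M B (pure_tensor H H (x \<otimes> u) (y \<otimes> v))) b"
      by (rule linear_map_sweedler[OF L vspace_HH M b]) (use xy in \<open>auto intro: bilinear_map_closed[OF P]\<close>)
    also have "\<dots> = sweedler H M (\<lambda>u v. B (x \<otimes> u) (y \<otimes> v)) b"
      by (rule sweedler_cong[OF b]) (use xy in \<open>simp add: tensor_lift_pure[OF vspace_H vspace_H M B]\<close>)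
    finally show "tensor_lift H H M B (sweedler H ?T (\<lambda>u v. pure_tensor H H (x \<otimes> u) (y \<otimes> v)) b) = \<dots>" .
  qed
  finally show ?thesis .
qed

text \<open>Both sides are images under the linear map sending \<open>x \<otimes> (y \<otimes> z)\<close> to \<open>T x y z\<close>: the right one
  of \<open>a\<^sub>(\<^sub>1\<^sub>) \<otimes> \<Delta>(a\<^sub>(\<^sub>2\<^sub>))\<close>, the left one of \<open>\<Delta>(a\<^sub>(\<^sub>1\<^sub>)) \<otimes> a\<^sub>(\<^sub>2\<^sub>)\<close> after reassociation. The map is
  the lift of \<open>D\<close>, and \<open>C\<close> below is the bilinear map whose lift reassociates. Trilinearity of
  \<open>T\<close> enters through the bilinearity of \<open>D\<close>.\<close>

lemma sweedler_coassoc: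
  assumes M: "vspace M" and a: "a \<in> carrier H"
    and T1: "\<And>y z. y \<in> carrier H \<Longrightarrow> z \<in> carrier H \<Longrightarrow> linear_map H M (\<lambda>x. T x y z)"
    and T2: "\<And>x z. x \<in> carrier H \<Longrightarrow> z \<in> carrier H \<Longrightarrow> linear_map H M (\<lambda>y. T x y z)"
    and T3: "\<And>x y. x \<in> carrier H \<Longrightarrow> y \<in> carrier H \<Longrightarrow> linear_map H M (\<lambda>z. T x y z)"
  shows "sweedler H M (\<lambda>x z. sweedler H M (\<lambda>u v. T u v z) x) a
    = sweedler H M (\<lambda>x z. sweedler H M (\<lambda>u v. T x u v) z) a"
proof -
  let ?T = "tensor_space H H"
  let ?TT = "tensor_space ?T H" and ?T' = "tensor_space H ?T"
  let ?p = "pure_tensor H H" and ?q = "pure_tensor H ?T" and ?r = "pure_tensor ?T H"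
  note VH = vspace_H and VT = vspace_HH
  note VTT = vspace_tensor_space[OF VT VH] and VT' = vspace_tensor_space[OF VH VT]
  note p = bilinear_map_pure_tensor[OF VH VH] and q = bilinear_map_pure_tensor[OF VH VT]
    and r = bilinear_map_pure_tensor[OF VT VH]
  note cl = linear_map_closed[OF comult_linear]
  define C where "C t w = tensor_lift H H ?T' (\<lambda>u v. ?q u (?p v w)) t" for t w
  have qp: "bilinear_map H H ?T' (\<lambda>u v. ?q u (?p v w))" if "w \<in> carrier H" for w
    by (rule bilinear_map_comp[OF q linear_map_id bilinear_map_left[OF p that]])
  have C: "bilinear_map ?T H ?T' C"
    unfolding C_def
    by (intro bilinear_mapI linear_map_tensor_lift linear_map_tensor_lift_fun VH VT' qp;
        (assumption | intro linear_map_comp[OF bilinear_map_right[OF q] bilinear_map_right[OF p]]))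
  define D where "D x t = tensor_lift H H M (T x) t" for x t
  have Tb: "bilinear_map H H M (T x)" if "x \<in> carrier H" for x
    by (intro bilinear_mapI T2 T3 that)
  have D: "bilinear_map H ?T M D"
    unfolding D_def
    by (intro bilinear_mapI linear_map_tensor_lift linear_map_tensor_lift_fun VH M Tb T1; assumption)
  let ?\<Phi> = "tensor_lift H ?T M D"
  note \<Phi> = linear_map_tensor_lift[OF VH VT M D] and \<Phi>p = tensor_lift_pure[OF VH VT M D]
  have rb: "bilinear_map H H ?TT (\<lambda>x z. ?r (comult H x) z)"
    by (rule bilinear_map_comp[OF r comult_linear linear_map_id])
  have qb: "bilinear_map H H ?T' (\<lambda>x z. ?q x (comult H z))"
    by (rule bilinear_map_comp[OF q linear_map_id comult_linear])
  have "tensor_map H H ?T H (comult H) (\<lambda>x. x) (comult H a)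
      = sweedler H ?TT (\<lambda>x z. ?r (comult H x) z) a"
    unfolding tensor_map_def by (rule tensor_lift_comult[OF VTT rb a])
  then have "tensor_assoc H H H (tensor_map H H ?T H (comult H) (\<lambda>x. x) (comult H a))
      = tensor_lift ?T H ?T' C (sweedler H ?TT (\<lambda>x z. ?r (comult H x) z) a)"
    by (simp add: tensor_assoc_def Let_def C_def[abs_def])
  also have "\<dots> = sweedler H ?T' (\<lambda>x z. tensor_lift ?T H ?T' C (?r (comult H x) z)) a"
    by (rule linear_map_sweedler[OF linear_map_tensor_lift[OF VT VH VT' C] VTT VT' a])
      (rule bilinear_map_closed[OF rb])
  also have "\<dots> = sweedler H ?T' (\<lambda>x z. sweedler H ?T' (\<lambda>u v. ?q u (?p v z)) x) a"
    by (rule sweedler_cong[OF a])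
      (simp add: tensor_lift_pure[OF VT VH VT' C] cl C_def tensor_lift_comult[OF VT' qp])
  also have "tensor_assoc H H H (tensor_map H H ?T H (comult H) (\<lambda>x. x) (comult H a))
      = tensor_map H H H ?T (\<lambda>x. x) (comult H) (comult H a)" by (rule coassoc[OF a])
  also have "\<dots> = sweedler H ?T' (\<lambda>x z. ?q x (comult H z)) a"
    unfolding tensor_map_def by (rule tensor_lift_comult[OF VT' qb a])
  finally have eq: "\<dots> = sweedler H ?T' (\<lambda>x z. sweedler H ?T' (\<lambda>u v. ?q u (?p v z)) x) a" .
  have "?\<Phi> (sweedler H ?T' (\<lambda>x z. ?q x (comult H z)) a) = sweedler H M (\<lambda>x z. ?\<Phi> (?q x (comult H z))) a"
    by (rule linear_map_sweedler[OF \<Phi> VT' M a bilinear_map_closed[OF qb]])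
  also have "\<dots> = sweedler H M (\<lambda>x z. sweedler H M (\<lambda>u v. T x u v) z) a"
    by (rule sweedler_cong[OF a]) (simp add: \<Phi>p cl D_def tensor_lift_comult[OF M Tb])
  finally have right: "?\<Phi> (sweedler H ?T' (\<lambda>x z. ?q x (comult H z)) a) = \<dots>" .
  have "?\<Phi> (sweedler H ?T' (\<lambda>x z. sweedler H ?T' (\<lambda>u v. ?q u (?p v z)) x) a)
      = sweedler H M (\<lambda>x z. ?\<Phi> (sweedler H ?T' (\<lambda>u v. ?q u (?p v z)) x)) a"
    by (rule linear_map_sweedler[OF \<Phi> VT' M a]) (intro sweedler_closed VT' bilinear_map_closed[OF qp])
  also have "\<dots> = sweedler H M (\<lambda>x z. sweedler H M (\<lambda>u v. T u v z) x) a"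
  proof (rule sweedler_cong[OF a])
    fix x z assume xz: "x \<in> carrier H" "z \<in> carrier H"
    have "?\<Phi> (sweedler H ?T' (\<lambda>u v. ?q u (?p v z)) x) = sweedler H M (\<lambda>u v. ?\<Phi> (?q u (?p v z))) x"
      by (rule linear_map_sweedler[OF \<Phi> VT' M xz(1) bilinear_map_closed[OF qp[OF xz(2)]]])
    also have "\<dots> = sweedler H M (\<lambda>u v. T u v z) x"
      by (rule sweedler_cong[OF xz(1)])
        (simp add: \<Phi>p bilinear_map_closed[OF p] xz(2) D_def tensor_lift_pure[OF VH VH M Tb])
    finally show "?\<Phi> (sweedler H ?T' (\<lambda>u v. ?q u (?p v z)) x) = \<dots>" .
  qed
  finally show ?thesis using right by (simp only: eq)
qed

end

section \<open>The antipode is antimultiplicative\<close>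

context hopf_algebra
begin

lemma counit_mult: "a \<in> carrier H \<Longrightarrow> b \<in> carrier H \<Longrightarrow> counit H (a \<otimes> b) = counit H a * counit H b"
  and counit_unit: "counit H \<one> = 1"
  using ring_hom_mult[OF counit_hom] ring_hom_one[OF counit_hom] by simp_all

lemma smult_smult: "x \<in> carrier H \<Longrightarrow> c \<odot> (d \<odot> x) = (c * d) \<odot> x"
  by (rule vspace_smult_smult[OF vspace_H])

lemma smult_one: "x \<in> carrier H \<Longrightarrow> 1 \<odot> x = x"
  by (rule vspace_smult_one[OF vspace_H])

lemma antipode_smult: "x \<in> carrier H \<Longrightarrow> antipode H (c \<odot> x) = c \<odot> antipode H x"
  by (rule linear_map_smult[OF antipode_linear])

lemma sweedler_counit_left: "a \<in> carrier H \<Longrightarrow> sweedler H H (\<lambda>x y. counit H x \<odot> y) a = a"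
  and sweedler_counit_right: "a \<in> carrier H \<Longrightarrow> sweedler H H (\<lambda>x y. counit H y \<odot> x) a = a"
  and sweedler_antipode_left: "a \<in> carrier H \<Longrightarrow>
    sweedler H H (\<lambda>x y. antipode H x \<otimes> y) a = counit H a \<odot> \<one>"
  and sweedler_antipode_right: "a \<in> carrier H \<Longrightarrow>
    sweedler H H (\<lambda>x y. x \<otimes> antipode H y) a = counit H a \<odot> \<one>"
  by (subst tensor_lift_comult[symmetric],
      (auto intro!: vspace_H bilinear_mapI linear_intros)[3],
      simp add: counit_left counit_right antipode_left antipode_right)+

lemma antipode_unit: "antipode H \<one> = \<one>"
proof -
  have "sweedler H H (\<lambda>x y. antipode H x \<otimes> y) \<one> = antipode H \<one> \<otimes> \<one>"
    by (rule sweedler_one[OF vspace_H]) (intro bilinear_mapI linear_intros; simp)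
  then show ?thesis by (simp add: sweedler_antipode_left counit_unit smult_one mult_unit_right)
qed

lemma counit_sweedler:
  assumes "a \<in> carrier H" "\<And>x y. x \<in> carrier H \<Longrightarrow> y \<in> carrier H \<Longrightarrow> B x y \<in> carrier H"
  shows "counit H (sweedler H H B a) = sweedler H complex_alg (\<lambda>x y. counit H (B x y)) a"
  by (rule linear_map_sweedler[OF counit_linear vspace_H vspace_complex_alg assms])

lemma counit_smult: "a \<in> carrier H \<Longrightarrow> counit H (c \<odot> a) = c * counit H a"
  using linear_map_smult[OF counit_linear, of a c] by simp

text \<open>Expand \<open>a\<close> as \<open>a\<^sub>(\<^sub>1\<^sub>) \<epsilon>(a\<^sub>(\<^sub>2\<^sub>))\<close>: the value \<open>\<epsilon>(S(a))\<close> becomes \<open>\<epsilon>(S(a\<^sub>(\<^sub>1\<^sub>)) a\<^sub>(\<^sub>2\<^sub>))\<close>, and the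
  argument of this outer counit is \<open>\<epsilon>(a) 1\<close>.\<close>

lemma counit_antipode:
  assumes a: "a \<in> carrier H"
  shows "counit H (antipode H a) = counit H a"
proof -
  have "counit H (antipode H a) = counit H (antipode H (sweedler H H (\<lambda>x y. counit H y \<odot> x) a))"
    by (simp add: sweedler_counit_right a)
  also have "\<dots> = counit H (sweedler H H (\<lambda>x y. antipode H (counit H y \<odot> x)) a)"
    by (simp add: sweedler_antipode a)
  also have "\<dots> = sweedler H complex_alg (\<lambda>x y. counit H (antipode H x \<otimes> y)) a"
    by (subst counit_sweedler)
      (auto simp: a antipode_smult counit_smult counit_mult intro!: sweedler_cong)
  also have "\<dots> = counit H (sweedler H H (\<lambda>x y. antipode H x \<otimes> y) a)"
    by (rule counit_sweedler[symmetric]) (simp_all add: a)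
  also have "\<dots> = counit H a"
    by (simp add: sweedler_antipode_left a counit_smult counit_unit)
  finally show ?thesis .
qed

text \<open>On the tensor square, \<open>S(a b)\<close> is a left and \<open>S(b) S(a)\<close> a right convolution inverse of the
  multiplication, so they agree. Concretely, the sum of
  \<open>S(a\<^sub>(\<^sub>1\<^sub>) b\<^sub>(\<^sub>1\<^sub>)) a\<^sub>(\<^sub>2\<^sub>) b\<^sub>(\<^sub>2\<^sub>) S(b\<^sub>(\<^sub>3\<^sub>)) S(a\<^sub>(\<^sub>3\<^sub>))\<close> is evaluated in two ways. Contracting \<open>b\<^sub>(\<^sub>2\<^sub>) S(b\<^sub>(\<^sub>3\<^sub>))\<close>
  and then \<open>a\<^sub>(\<^sub>2\<^sub>) S(a\<^sub>(\<^sub>3\<^sub>))\<close> leaves \<open>S(a b)\<close>. Contracting the first three factors by the antipode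
  axiom at the product of the two initial legs leaves \<open>S(b) S(a)\<close>. Coassociativity in \<open>a\<close> and
  in \<open>b\<close> relates the two bracketings.\<close>

lemma antipode_mult:
  assumes a: "a \<in> carrier H" and b: "b \<in> carrier H"
  shows "antipode H (a \<otimes> b) = antipode H b \<otimes> antipode H a"
proof -
  let ?S = "antipode H" and ?sw = "sweedler H H" and ?\<epsilon> = "counit H"
  define E where "E a1 a2 a3 b1 b2 b3 = ?S (a1 \<otimes> b1) \<otimes> ((a2 \<otimes> b2) \<otimes> (?S b3 \<otimes> ?S a3))"
    for a1 a2 a3 b1 b2 b3
  note simps = smult_mult_left smult_mult_right smult_smult antipode_smult mult_assoc
    sweedler_mult_left sweedler_mult_right sweedler_smult sweedler_antipode_left sweedler_antipode_right
    mult_unit_left mult_unit_right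
  have Ecl: "E a1 a2 a3 b1 b2 b3 \<in> carrier H"
    if "a1 \<in> carrier H" "a2 \<in> carrier H" "a3 \<in> carrier H" "b1 \<in> carrier H" "b2 \<in> carrier H" "b3 \<in> carrier H"
    for a1 a2 a3 b1 b2 b3
    using that by (simp add: E_def)
  have Eb: "?sw (\<lambda>y b3. ?sw (\<lambda>b1 b2. E a1 a2 a3 b1 b2 b3) y) b = ?sw (\<lambda>b1 y. ?sw (\<lambda>b2 b3. E a1 a2 a3 b1 b2 b3) y) b"
    if "a1 \<in> carrier H" "a2 \<in> carrier H" "a3 \<in> carrier H" for a1 a2 a3
    unfolding E_def
    by (rule sweedler_coassoc[OF vspace_H b]; intro linear_intros; simp add: that)
  have Ea: "?sw (\<lambda>x a3. ?sw (\<lambda>a1 a2. ?sw (\<lambda>b1 y. ?sw (\<lambda>b2 b3. E a1 a2 a3 b1 b2 b3) y) b) x) a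
      = ?sw (\<lambda>a1 x. ?sw (\<lambda>a2 a3. ?sw (\<lambda>b1 y. ?sw (\<lambda>b2 b3. E a1 a2 a3 b1 b2 b3) y) b) x) a"
    unfolding E_def
    by (rule sweedler_coassoc[OF vspace_H a]; intro linear_map_sweedler_fun vspace_H b linear_intros; simp)
  \<comment> \<open>first evaluation: contract the last two legs of \<open>b\<close>, then those of \<open>a\<close>\<close>
  have inner_b: "?sw (\<lambda>b2 b3. E a1 a2 a3 b1 b2 b3) y = ?\<epsilon> y \<odot> (?S (a1 \<otimes> b1) \<otimes> (a2 \<otimes> ?S a3))"
    if "a1 \<in> carrier H" "a2 \<in> carrier H" "a3 \<in> carrier H" "b1 \<in> carrier H" "y \<in> carrier H" for a1 a2 a3 b1 y
  proof -
    have "?sw (\<lambda>b2 b3. E a1 a2 a3 b1 b2 b3) y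
        = ?sw (\<lambda>b2 b3. ?S (a1 \<otimes> b1) \<otimes> (a2 \<otimes> ((b2 \<otimes> ?S b3) \<otimes> ?S a3))) y"
      by (rule sweedler_cong) (use that in \<open>simp_all add: E_def mult_assoc\<close>)
    then show ?thesis using that by (simp add: simps del: mult_assoc)
  qed
  have inner_a: "?sw (\<lambda>a2 a3. ?sw (\<lambda>b2 b3. E a1 a2 a3 b1 b2 b3) y) x
      = ?S ((?\<epsilon> x \<odot> a1) \<otimes> (?\<epsilon> y \<odot> b1))"
    if "a1 \<in> carrier H" "x \<in> carrier H" "b1 \<in> carrier H" "y \<in> carrier H" for a1 x b1 y
  proof -
    have "?sw (\<lambda>a2 a3. ?sw (\<lambda>b2 b3. E a1 a2 a3 b1 b2 b3) y) x
        = ?sw (\<lambda>a2 a3. ?\<epsilon> y \<odot> (?S (a1 \<otimes> b1) \<otimes> (a2 \<otimes> ?S a3))) x"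
      by (rule sweedler_cong) (use that in \<open>simp_all add: inner_b\<close>)
    then show ?thesis using that by (simp add: simps mult.commute)
  qed
  have "?sw (\<lambda>a1 x. ?sw (\<lambda>a2 a3. ?sw (\<lambda>b1 y. ?sw (\<lambda>b2 b3. E a1 a2 a3 b1 b2 b3) y) b) x) a
      = ?sw (\<lambda>a1 x. ?sw (\<lambda>b1 y. ?S ((?\<epsilon> x \<odot> a1) \<otimes> (?\<epsilon> y \<odot> b1))) b) a"
  proof (rule sweedler_cong[OF a])
    fix a1 x assume [simp]: "a1 \<in> carrier H" "x \<in> carrier H"
    have "?sw (\<lambda>a2 a3. ?sw (\<lambda>b1 y. ?sw (\<lambda>b2 b3. E a1 a2 a3 b1 b2 b3) y) b) x
        = ?sw (\<lambda>b1 y. ?sw (\<lambda>a2 a3. ?sw (\<lambda>b2 b3. E a1 a2 a3 b1 b2 b3) y) x) b"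
      by (rule sweedler_swap[OF vspace_H]) (simp_all add: b Ecl)
    also have "\<dots> = ?sw (\<lambda>b1 y. ?S ((?\<epsilon> x \<odot> a1) \<otimes> (?\<epsilon> y \<odot> b1))) b"
      by (rule sweedler_cong[OF b]) (simp add: inner_a)
    finally show "?sw (\<lambda>a2 a3. ?sw (\<lambda>b1 y. ?sw (\<lambda>b2 b3. E a1 a2 a3 b1 b2 b3) y) b) x = \<dots>" .
  qed
  also have "\<dots> = ?sw (\<lambda>a1 x. ?S ((?\<epsilon> x \<odot> a1) \<otimes> b)) a"
    by (rule sweedler_cong[OF a])
      (simp add: b sweedler_antipode sweedler_mult_left sweedler_counit_right)
  also have "\<dots> = ?S (a \<otimes> b)"
    by (simp add: a b sweedler_antipode sweedler_mult_right sweedler_counit_right)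
  finally have 1: "?sw (\<lambda>a1 x. ?sw (\<lambda>a2 a3. ?sw (\<lambda>b1 y. ?sw (\<lambda>b2 b3. E a1 a2 a3 b1 b2 b3) y) b) x) a
      = ?S (a \<otimes> b)" .
  \<comment> \<open>second evaluation: the first two legs of \<open>a\<close> and \<open>b\<close> are those of one product \<open>x y\<close>\<close>
  have prod: "?sw (\<lambda>a1 a2. ?sw (\<lambda>b1 b2. E a1 a2 a3 b1 b2 b3) y) x
      = ?S (?\<epsilon> y \<odot> b3) \<otimes> ?S (?\<epsilon> x \<odot> a3)"
    if [simp]: "x \<in> carrier H" "y \<in> carrier H" "a3 \<in> carrier H" "b3 \<in> carrier H" for x y a3 b3
  proof -
    have "?sw (\<lambda>a1 a2. ?sw (\<lambda>b1 b2. E a1 a2 a3 b1 b2 b3) y) x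
        = ?sw (\<lambda>u v. ?S u \<otimes> (v \<otimes> (?S b3 \<otimes> ?S a3))) (x \<otimes> y)"
      unfolding E_def
      by (rule sweedler_mult[OF vspace_H, symmetric]) (simp_all add: bilinear_mapI linear_intros)
    also have "\<dots> = ?sw (\<lambda>u v. (?S u \<otimes> v) \<otimes> (?S b3 \<otimes> ?S a3)) (x \<otimes> y)"
      by (rule sweedler_cong) (simp_all add: mult_assoc)
    also have "\<dots> = ?S (?\<epsilon> y \<odot> b3) \<otimes> ?S (?\<epsilon> x \<odot> a3)"
      by (simp add: simps counit_mult mult.commute)
    finally show ?thesis .
  qed
  have "?sw (\<lambda>x a3. ?sw (\<lambda>a1 a2. ?sw (\<lambda>b1 y. ?sw (\<lambda>b2 b3. E a1 a2 a3 b1 b2 b3) y) b) x) a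
      = ?sw (\<lambda>x a3. ?sw (\<lambda>y b3. ?S (?\<epsilon> y \<odot> b3) \<otimes> ?S (?\<epsilon> x \<odot> a3)) b) a"
  proof (rule sweedler_cong[OF a])
    fix x a3 assume [simp]: "x \<in> carrier H" "a3 \<in> carrier H"
    have "?sw (\<lambda>a1 a2. ?sw (\<lambda>b1 y. ?sw (\<lambda>b2 b3. E a1 a2 a3 b1 b2 b3) y) b) x
        = ?sw (\<lambda>a1 a2. ?sw (\<lambda>y b3. ?sw (\<lambda>b1 b2. E a1 a2 a3 b1 b2 b3) y) b) x"
      by (rule sweedler_cong) (simp_all add: Eb)
    also have "\<dots> = ?sw (\<lambda>y b3. ?sw (\<lambda>a1 a2. ?sw (\<lambda>b1 b2. E a1 a2 a3 b1 b2 b3) y) x) b"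
      by (rule sweedler_swap[OF vspace_H]) (simp_all add: b Ecl)
    also have "\<dots> = ?sw (\<lambda>y b3. ?S (?\<epsilon> y \<odot> b3) \<otimes> ?S (?\<epsilon> x \<odot> a3)) b"
      by (rule sweedler_cong[OF b]) (simp add: prod)
    finally show "?sw (\<lambda>a1 a2. ?sw (\<lambda>b1 y. ?sw (\<lambda>b2 b3. E a1 a2 a3 b1 b2 b3) y) b) x = \<dots>" .
  qed
  also have "\<dots> = ?sw (\<lambda>x a3. ?S b \<otimes> ?S (?\<epsilon> x \<odot> a3)) a"
    by (rule sweedler_cong[OF a])
      (simp add: b sweedler_antipode sweedler_mult_right sweedler_counit_left)
  also have "\<dots> = ?S b \<otimes> ?S a"
    by (simp add: a b sweedler_antipode sweedler_mult_left sweedler_counit_left)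
  finally show ?thesis using 1 Ea by simp
qed

end

section \<open>The antipode and the star\<close>

lemma antilinear_mapD:
  assumes "antilinear_map V W f"
  shows antilinear_map_closed: "x \<in> carrier V \<Longrightarrow> f x \<in> carrier W"
    and antilinear_map_add: "x \<in> carrier V \<Longrightarrow> y \<in> carrier V \<Longrightarrow> f (x \<oplus>\<^bsub>V\<^esub> y) = f x \<oplus>\<^bsub>W\<^esub> f y"
    and antilinear_map_smult: "x \<in> carrier V \<Longrightarrow> f (c \<odot>\<^bsub>V\<^esub> x) = cnj c \<odot>\<^bsub>W\<^esub> f x"
  using assms by (auto simp: antilinear_map_def)

text \<open>An antilinear map is a linear map into the conjugate space, so everything proved for linear
  maps applies to it.\<close>

lemma linear_map_Conj_iff: "linear_map V (conj_space W) (\<lambda>x. Conj (f x)) \<longleftrightarrow> antilinear_map V W f"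
  by (auto simp: linear_map_def antilinear_map_def Pi_iff)

lemma list_sum_conj_space: "list_sum (conj_space M) (\<lambda>x. Conj (f x)) xs = Conj (list_sum M f xs)"
  by (induction xs) auto

context hopf_star_algebra
begin

lemma sweedler_conj_space: "sweedler H (conj_space M) (\<lambda>x y. Conj (B x y)) a = Conj (sweedler H M B a)"
proof -
  have "(\<lambda>(x, y). Conj (B x y)) = (\<lambda>p. Conj (case p of (x, y) \<Rightarrow> B x y))" by auto
  then show ?thesis by (simp add: sweedler_def list_sum_conj_space)
qed

lemma star_closed [simp]: "a \<in> carrier H \<Longrightarrow> star H a \<in> carrier H"
  by (rule antilinear_map_closed[OF star_antilinear])

lemma star_smult: "a \<in> carrier H \<Longrightarrow> star H (c \<odot> a) = cnj c \<odot> star H a"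
  by (rule antilinear_map_smult[OF star_antilinear])

lemma star_sweedler:
  assumes "a \<in> carrier H" "\<And>x y. x \<in> carrier H \<Longrightarrow> y \<in> carrier H \<Longrightarrow> B x y \<in> carrier H"
  shows "star H (sweedler H H B a) = sweedler H H (\<lambda>x y. star H (B x y)) a"
  using linear_map_sweedler[OF linear_map_Conj_iff[THEN iffD2, OF star_antilinear] vspace_H
      vspace_conj_space[OF vspace_H] assms]
  by (simp add: sweedler_conj_space)

text \<open>The compatibility of the coproduct with the star, evaluated at a bilinear map.\<close>

lemma sweedler_star:
  assumes M: "vspace M" and B: "bilinear_map H H M B" and a: "a \<in> carrier H"
  shows "sweedler H M B (star H a) = sweedler H M (\<lambda>x y. B (star H x) (star H y)) a"
proof -
  let ?T = "tensor_space H H" and ?p = "pure_tensor H H"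
  note p = bilinear_map_pure_tensor[OF vspace_H vspace_H]
  have "bilinear_map H H (conj_space ?T) (\<lambda>x y. Conj (?p (star H x) (star H y)))"
    by (intro bilinear_mapI; unfold linear_map_Conj_iff antilinear_map_def)
      (auto simp: antilinear_mapD[OF star_antilinear] bilinear_map_closed[OF p]
        linear_map_add[OF bilinear_map_left[OF p]] linear_map_smult[OF bilinear_map_left[OF p]]
        linear_map_add[OF bilinear_map_right[OF p]] linear_map_smult[OF bilinear_map_right[OF p]])
  from tensor_lift_comult[OF vspace_conj_space[OF vspace_HH] this a]
  have eq: "comult H (star H a) = sweedler H ?T (\<lambda>x y. ?p (star H x) (star H y)) a"
    by (simp add: star_comult[OF a] antilinear_tensor_map_def sweedler_conj_space)
  have "sweedler H M B (star H a) = tensor_lift H H M B (comult H (star H a))"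
    by (rule tensor_lift_comult[OF M B, symmetric]) (simp add: a)
  also have "\<dots> = sweedler H M (\<lambda>x y. tensor_lift H H M B (?p (star H x) (star H y))) a"
    unfolding eq
    by (rule linear_map_sweedler[OF linear_map_tensor_lift[OF vspace_H vspace_H M B] vspace_HH M a])
      (simp add: bilinear_map_closed[OF p])
  also have "\<dots> = sweedler H M (\<lambda>x y. B (star H x) (star H y)) a"
    by (rule sweedler_cong[OF a]) (simp add: tensor_lift_pure[OF vspace_H vspace_H M B])
  finally show ?thesis .
qed

lemma star_unit: "star H \<one> = \<one>"
proof -
  have "star H (star H \<one> \<otimes> \<one>) = star H \<one> \<otimes> \<one>"
    by (subst star_mult) (simp_all add: star_star mult_unit_left mult_unit_right)
  then show ?thesis by (simp add: mult_unit_right star_star)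
qed

text \<open>The map \<open>a \<mapsto> cnj (\<epsilon>(a\<^sup>*))\<close> is linear and, by applying the star to the left counit law at
  \<open>a\<^sup>*\<close>, satisfies that law too. A left counit \<open>e\<close> agrees with the right counit \<open>\<epsilon>\<close>, because
  \<open>e(a\<^sub>(\<^sub>1\<^sub>)) \<epsilon>(a\<^sub>(\<^sub>2\<^sub>))\<close> equals both.\<close>

lemma counit_star:
  assumes a: "a \<in> carrier H"
  shows "counit H (star H a) = cnj (counit H a)"
proof -
  let ?e = "\<lambda>a. cnj (counit H (star H a))"
  have e_left: "sweedler H H (\<lambda>x y. ?e x \<odot> y) a = a"
  proof -
    have "sweedler H H (\<lambda>x y. counit H x \<odot> y) (star H a)
        = sweedler H H (\<lambda>x y. counit H (star H x) \<odot> star H y) a"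
      by (rule sweedler_star[OF vspace_H _ a]) (auto intro!: bilinear_mapI linear_intros)
    then have "star H (star H a) = star H (sweedler H H (\<lambda>x y. counit H (star H x) \<odot> star H y) a)"
      by (simp add: sweedler_counit_left a)
    also have "\<dots> = sweedler H H (\<lambda>x y. ?e x \<odot> y) a"
      by (subst star_sweedler) (auto simp: a star_smult star_star intro!: sweedler_cong)
    finally show ?thesis by (simp add: star_star a)
  qed
  have "linear_map H complex_alg ?e"
    by (rule linear_mapI) (simp_all add: antilinear_map_add[OF star_antilinear] star_smult counit_smult
      linear_map_add[OF counit_linear])
  note e = linear_map_sweedler[OF this vspace_H vspace_complex_alg a]
  have "counit H a = counit H (sweedler H H (\<lambda>x y. ?e x \<odot> y) a)" by (simp add: e_left)
  also have "\<dots> = sweedler H complex_alg (\<lambda>x y. ?e (counit H y \<odot> x)) a"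
    by (subst counit_sweedler) (auto simp: a counit_smult star_smult intro!: sweedler_cong)
  also have "\<dots> = ?e (sweedler H H (\<lambda>x y. counit H y \<odot> x) a)"
    by (rule e[symmetric]) simp
  also have "\<dots> = ?e a" by (simp add: sweedler_counit_right a)
  finally show ?thesis by simp
qed

text \<open>Put \<open>T(a) = S(a\<^sup>*)\<^sup>*\<close>. The star turns the antipode law at \<open>a\<^sup>*\<close> into
  \<open>a\<^sub>(\<^sub>2\<^sub>) T(a\<^sub>(\<^sub>1\<^sub>)) = \<epsilon>(a) 1\<close>, so \<open>T\<close> is an antipode for the opposite multiplication. Since \<open>S\<close> is
  antimultiplicative, applying it gives \<open>S(T(a\<^sub>(\<^sub>1\<^sub>))) S(a\<^sub>(\<^sub>2\<^sub>)) = \<epsilon>(a) 1\<close>. Thus \<open>S \<circ> T\<close> is a left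
  convolution inverse of \<open>S\<close>, whereas the identity is a right one, and the two agree.\<close>

lemma antipode_star_antipode_star:
  assumes a: "a \<in> carrier H"
  shows "antipode H (star H (antipode H (star H a))) = a"
proof -
  define T where "T a = star H (antipode H (star H a))" for a
  have T_closed [simp]: "x \<in> carrier H \<Longrightarrow> T x \<in> carrier H" for x by (simp add: T_def)
  have T_linear: "linear_map H H T"
    unfolding T_def
    by (rule linear_mapI) (simp_all add: antilinear_mapD[OF star_antilinear] linear_mapD[OF antipode_linear])
  have T_inverse: "sweedler H H (\<lambda>x y. y \<otimes> T x) x = counit H x \<odot> \<one>" if x: "x \<in> carrier H" for x
  proof -
    have "counit H (star H x) \<odot> \<one> = sweedler H H (\<lambda>x y. antipode H (star H x) \<otimes> star H y) x"
      unfolding sweedler_antipode_left[OF star_closed[OF x], symmetric]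
      by (rule sweedler_star[OF vspace_H _ x]) (auto intro!: bilinear_mapI linear_intros)
    then have "star H (counit H (star H x) \<odot> \<one>)
        = star H (sweedler H H (\<lambda>x y. antipode H (star H x) \<otimes> star H y) x)" by simp
    also have "\<dots> = sweedler H H (\<lambda>x y. y \<otimes> T x) x"
      by (subst star_sweedler) (auto simp: x star_mult star_star T_def intro!: sweedler_cong)
    finally show ?thesis by (simp add: x star_smult star_unit counit_star)
  qed
  have ST: "sweedler H H (\<lambda>x y. antipode H (T x) \<otimes> antipode H y) x = counit H x \<odot> \<one>"
    if x: "x \<in> carrier H" for x
  proof -
    have "sweedler H H (\<lambda>x y. antipode H (T x) \<otimes> antipode H y) x
        = sweedler H H (\<lambda>x y. antipode H (y \<otimes> T x)) x"
      by (rule sweedler_cong[OF x]) (simp add: antipode_mult)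
    then show ?thesis by (simp add: sweedler_antipode x T_inverse antipode_smult antipode_unit)
  qed
  have "a = sweedler H H (\<lambda>x z. counit H x \<odot> z) a" by (simp add: sweedler_counit_left a)
  also have "\<dots> = sweedler H H (\<lambda>x z. sweedler H H (\<lambda>u v. (antipode H (T u) \<otimes> antipode H v) \<otimes> z) x) a"
    by (rule sweedler_cong[OF a]) (simp add: sweedler_mult_right ST smult_mult_left mult_unit_left)
  also have "\<dots> = sweedler H H (\<lambda>x z. sweedler H H (\<lambda>u v. (antipode H (T x) \<otimes> antipode H u) \<otimes> v) z) a"
    by (rule sweedler_coassoc[OF vspace_H a]; intro linear_intros T_linear; simp)
  also have "\<dots> = sweedler H H (\<lambda>x z. antipode H (T (counit H z \<odot> x))) a"
  proof (rule sweedler_cong[OF a])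
    fix x z assume [simp]: "x \<in> carrier H" "z \<in> carrier H"
    have "sweedler H H (\<lambda>u v. (antipode H (T x) \<otimes> antipode H u) \<otimes> v) z
        = sweedler H H (\<lambda>u v. antipode H (T x) \<otimes> (antipode H u \<otimes> v)) z"
      by (rule sweedler_cong) (simp_all add: mult_assoc)
    also have "\<dots> = antipode H (T (counit H z \<odot> x))"
      by (simp add: sweedler_mult_left sweedler_antipode_left smult_mult_right mult_unit_right
          linear_map_smult[OF T_linear] antipode_smult)
    finally show "sweedler H H (\<lambda>u v. (antipode H (T x) \<otimes> antipode H u) \<otimes> v) z = \<dots>" .
  qed
  also have "\<dots> = antipode H (T a)"
    using linear_map_sweedler[OF linear_map_antipode[OF T_linear] vspace_H vspace_H a, of "\<lambda>x y. counit H y \<odot> x"]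
    by (simp add: sweedler_counit_right a)
  finally show ?thesis by (simp add: T_def)
qed

lemma star_antipode_star_antipode:
  assumes a: "a \<in> carrier H"
  shows "star H (antipode H (star H (antipode H a))) = a"
  using antipode_star_antipode_star[OF star_closed[OF a]] by (simp add: star_star a)

end

section \<open>Conjugate, trivial and direct sum modules\<close>

lemma with_act_sel [simp]:
  "carrier (with_act V r) = carrier V" "\<zero>\<^bsub>with_act V r\<^esub> = \<zero>\<^bsub>V\<^esub>"
  "x \<oplus>\<^bsub>with_act V r\<^esub> y = x \<oplus>\<^bsub>V\<^esub> y" "c \<odot>\<^bsub>with_act V r\<^esub> x = c \<odot>\<^bsub>V\<^esub> x"
  "a \<rhd>\<^bsub>with_act V r\<^esub> x = r a x"
  by (simp_all add: module.defs hmod.defs)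

lemma vspace_with_act: "vspace V \<Longrightarrow> vspace (with_act V r)"
  by (rule vspaceI) (simp_all add: vspaceD)

lemma hmoduleD:
  assumes "hmodule H V"
  shows hmodule_vspace: "vspace V"
    and act_linear: "a \<in> carrier H \<Longrightarrow> linear_map V V (\<lambda>v. a \<rhd>\<^bsub>V\<^esub> v)"
    and act_linear_left: "v \<in> carrier V \<Longrightarrow> linear_map H V (\<lambda>a. a \<rhd>\<^bsub>V\<^esub> v)"
    and act_mult: "a \<in> carrier H \<Longrightarrow> b \<in> carrier H \<Longrightarrow> v \<in> carrier V \<Longrightarrow>
      (a \<otimes>\<^bsub>H\<^esub> b) \<rhd>\<^bsub>V\<^esub> v = a \<rhd>\<^bsub>V\<^esub> b \<rhd>\<^bsub>V\<^esub> v"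
    and act_one: "v \<in> carrier V \<Longrightarrow> \<one>\<^bsub>H\<^esub> \<rhd>\<^bsub>V\<^esub> v = v"
  using assms by (auto simp: hmodule_def)

lemma act_closed: "hmodule H V \<Longrightarrow> a \<in> carrier H \<Longrightarrow> v \<in> carrier V \<Longrightarrow> a \<rhd>\<^bsub>V\<^esub> v \<in> carrier V"
  by (rule linear_map_closed[OF act_linear])

lemma hmoduleI:
  assumes "vspace V" "\<And>a. a \<in> carrier H \<Longrightarrow> linear_map V V (\<lambda>v. a \<rhd>\<^bsub>V\<^esub> v)"
    and "\<And>v. v \<in> carrier V \<Longrightarrow> linear_map H V (\<lambda>a. a \<rhd>\<^bsub>V\<^esub> v)"
    and "\<And>a b v. a \<in> carrier H \<Longrightarrow> b \<in> carrier H \<Longrightarrow> v \<in> carrier V \<Longrightarrow>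
      (a \<otimes>\<^bsub>H\<^esub> b) \<rhd>\<^bsub>V\<^esub> v = a \<rhd>\<^bsub>V\<^esub> b \<rhd>\<^bsub>V\<^esub> v"
    and "\<And>v. v \<in> carrier V \<Longrightarrow> \<one>\<^bsub>H\<^esub> \<rhd>\<^bsub>V\<^esub> v = v"
  shows "hmodule H V"
  using assms by (auto simp: hmodule_def)

lemma hmodule_direct_sum_hmod:
  assumes H: "vspace H" and W: "\<And>j. j \<in> J \<Longrightarrow> hmodule H (W j)"
  shows "hmodule H (direct_sum_hmod J W)"
proof -
  let ?S = "direct_sum_space J W"
  note vs = hmodule_vspace[OF W]
  have mem: "v j \<in> carrier (W j)" if "v \<in> carrier ?S" "j \<in> J" for v j
    using that by auto
  have closed: "(\<lambda>j\<in>J. a \<rhd>\<^bsub>W j\<^esub> v j) \<in> carrier ?S" if a: "a \<in> carrier H" and v: "v \<in> carrier ?S" for a v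
  proof -
    have "{j \<in> J. (\<lambda>j\<in>J. a \<rhd>\<^bsub>W j\<^esub> v j) j \<noteq> \<zero>\<^bsub>W j\<^esub>} \<subseteq> {j \<in> J. v j \<noteq> \<zero>\<^bsub>W j\<^esub>}"
      using linear_map_zero[OF act_linear[OF W a] vs vs] by auto
    then have "finite {j \<in> J. (\<lambda>j\<in>J. a \<rhd>\<^bsub>W j\<^esub> v j) j \<noteq> \<zero>\<^bsub>W j\<^esub>}"
      by (rule finite_subset) (use v in auto)
    then show ?thesis using v mem[OF v] by (simp add: act_closed[OF W a])
  qed
  have ext: "(\<lambda>j\<in>J. v j) = v" if "v \<in> carrier ?S" for v
    using that by (auto simp: PiE_def extensional_restrict)
  note [simp del] = direct_sum_space_sel(1)
  note L = linear_mapD[OF act_linear[OF W]] linear_mapD[OF act_linear_left[OF W]]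
  show ?thesis
    unfolding direct_sum_hmod_def
  proof (rule hmoduleI)
    show "vspace (with_act ?S (\<lambda>a v. \<lambda>j\<in>J. a \<rhd>\<^bsub>W j\<^esub> v j))"
      by (intro vspace_with_act vspace_direct_sum_space vs)
  next
    fix v assume "v \<in> carrier (with_act ?S (\<lambda>a v. \<lambda>j\<in>J. a \<rhd>\<^bsub>W j\<^esub> v j))"
    then have v: "v \<in> carrier ?S" by simp
    have "(\<lambda>j\<in>J. \<one>\<^bsub>H\<^esub> \<rhd>\<^bsub>W j\<^esub> v j) = (\<lambda>j\<in>J. v j)"
      by (rule restrict_ext) (simp add: act_one[OF W] mem[OF v])
    then show "\<one>\<^bsub>H\<^esub> \<rhd>\<^bsub>with_act ?S (\<lambda>a v. \<lambda>j\<in>J. a \<rhd>\<^bsub>W j\<^esub> v j)\<^esub> v = v"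
      by (simp add: ext[OF v])
  qed ((rule linear_mapI)?; auto simp: mem L act_mult[OF W] intro!: closed restrict_ext)+
qed

context hopf_star_algebra
begin

text \<open>The map \<open>a \<mapsto> S(a)\<^sup>*\<close> is an antilinear ring endomorphism: two reversals of products cancel.
  This is what makes the conjugate of a module a module again.\<close>

lemma star_antipode_simps [simp]:
  shows "a \<in> carrier H \<Longrightarrow> b \<in> carrier H \<Longrightarrow> star H (antipode H (a \<otimes> b))
      = star H (antipode H a) \<otimes> star H (antipode H b)"
    and "star H (antipode H \<one>) = \<one>"
    and "a \<in> carrier H \<Longrightarrow> b \<in> carrier H \<Longrightarrow> star H (antipode H (a \<oplus> b))
      = star H (antipode H a) \<oplus> star H (antipode H b)"
    and "a \<in> carrier H \<Longrightarrow> star H (antipode H (c \<odot> a)) = cnj c \<odot> star H (antipode H a)"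
  by (simp_all add: antipode_mult star_mult antipode_unit star_unit linear_map_add[OF antipode_linear]
      antilinear_map_add[OF star_antilinear] antipode_smult star_smult)

lemma hmodule_conj_hmod:
  assumes V: "hmodule H V"
  shows "hmodule H (conj_hmod H V)"
proof -
  note L = linear_mapD[OF act_linear[OF V]] linear_mapD[OF act_linear_left[OF V]]
  show ?thesis
    unfolding conj_hmod_def
    by (rule hmoduleI; (rule vspace_with_act vspace_conj_space hmodule_vspace[OF V] |
          (rule linear_mapI)?; auto simp: L act_mult[OF V] act_one[OF V])+)
qed

lemma hmodule_trivial_hmod: "hmodule H (trivial_hmod H)"
  unfolding trivial_hmod_def
  by (rule hmoduleI; (rule vspace_with_act vspace_complex_alg | (rule linear_mapI)?;
        simp add: counit_mult counit_unit counit_smult linear_map_add[OF counit_linear] algebra_simps)+)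

text \<open>Equivariance of \<open>\<gamma>\<close> is the identity \<open>cnj (\<epsilon>(S(a)\<^sup>*)) = \<epsilon>(a)\<close>.\<close>

lemma hmodule_iso_gamma: "hmodule_iso H (conj_hmod H (trivial_hmod H)) (trivial_hmod H) gamma_map"
proof -
  have "bij_betw gamma_map (range Conj) UNIV"
    by (rule bij_betw_byWitness[where f' = "\<lambda>z. Conj (cnj z)"]) auto
  moreover have "linear_map (conj_hmod H (trivial_hmod H)) (trivial_hmod H) gamma_map"
    by (rule linear_mapI) (auto simp: conj_hmod_def trivial_hmod_def)
  moreover have "gamma_map (a \<rhd>\<^bsub>conj_hmod H (trivial_hmod H)\<^esub> x) = a \<rhd>\<^bsub>trivial_hmod H\<^esub> gamma_map x"
    if "a \<in> carrier H" for a x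
    using that by (cases x) (simp add: conj_hmod_def trivial_hmod_def counit_star counit_antipode)
  ultimately show ?thesis
    unfolding hmodule_iso_def hmodule_hom_def
    by (simp add: hmodule_conj_hmod hmodule_trivial_hmod) (simp add: conj_hmod_def trivial_hmod_def)
qed

text \<open>On the double conjugate, \<open>a\<close> acts as \<open>S(S(a)\<^sup>*)\<^sup>*\<close> does on \<open>V\<close>.\<close>

lemma hmodule_iso_sigma:
  assumes V: "hmodule H V"
  shows "hmodule_iso H (conj_hmod H (conj_hmod H V)) V sigma_map"
proof -
  have "bij_betw sigma_map (Conj ` Conj ` carrier V) (carrier V)"
    by (rule bij_betw_byWitness[where f' = "\<lambda>v. Conj (Conj v)"]) auto
  moreover have "linear_map (conj_hmod H (conj_hmod H V)) V sigma_map"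
    by (rule linear_mapI) (auto simp: conj_hmod_def)
  moreover have "sigma_map (a \<rhd>\<^bsub>conj_hmod H (conj_hmod H V)\<^esub> x) = a \<rhd>\<^bsub>V\<^esub> sigma_map x"
    if "a \<in> carrier H" "x \<in> carrier (conj_hmod H (conj_hmod H V))" for a x
    using that by (auto simp: conj_hmod_def star_antipode_star_antipode)
  ultimately show ?thesis
    unfolding hmodule_iso_def hmodule_hom_def
    by (simp add: hmodule_conj_hmod V) (simp add: conj_hmod_def)
qed

text \<open>Both modules twist every component in the same way, so equivariance is immediate, and the
  inverse unwraps each component. What needs an argument is that supports stay finite.\<close>

lemma hmodule_iso_pi:
  assumes W: "\<And>j. j \<in> J \<Longrightarrow> hmodule H (W j)"
  shows "hmodule_iso H (conj_hmod H (direct_sum_hmod J W)) (direct_sum_hmod J (\<lambda>j. conj_hmod H (W j)))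
    (pi_map J)"
proof -
  let ?X = "conj_hmod H (direct_sum_hmod J W)" and ?Y = "direct_sum_hmod J (\<lambda>j. conj_hmod H (W j))"
  have X: "x \<in> carrier ?X \<longleftrightarrow> (\<exists>v. x = Conj v \<and> v \<in> carrier (direct_sum_space J W))" for x
    by (auto simp: conj_hmod_def direct_sum_hmod_def simp del: direct_sum_space_sel(1))
  have Y: "y \<in> carrier ?Y \<longleftrightarrow> y \<in> (\<Pi>\<^sub>E j\<in>J. Conj ` carrier (W j)) \<and> finite {j\<in>J. y j \<noteq> Conj \<zero>\<^bsub>W j\<^esub>}" for y
    by (simp add: conj_hmod_def direct_sum_hmod_def)
  have supp: "{j \<in> J. (\<lambda>j\<in>J. Conj (v j)) j \<noteq> Conj \<zero>\<^bsub>W j\<^esub>} = {j \<in> J. v j \<noteq> \<zero>\<^bsub>W j\<^esub>}" for v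
    by auto
  have into: "pi_map J x \<in> carrier ?Y" if "x \<in> carrier ?X" for x
    using that supp unfolding X Y by fastforce
  have bij: "bij_betw (pi_map J) (carrier ?X) (carrier ?Y)"
  proof (rule bij_betw_byWitness[where f' = "\<lambda>y. Conj (\<lambda>j\<in>J. unconj (y j))"])
    show "\<forall>x\<in>carrier ?X. Conj (\<lambda>j\<in>J. unconj (pi_map J x j)) = x"
      by (auto simp: X fun_eq_iff PiE_def extensional_def)
    show "\<forall>y\<in>carrier ?Y. pi_map J (Conj (\<lambda>j\<in>J. unconj (y j))) = y"
      by (auto simp: Y fun_eq_iff PiE_def extensional_def)
    show "pi_map J ` carrier ?X \<subseteq> carrier ?Y" using into by auto
    show "(\<lambda>y. Conj (\<lambda>j\<in>J. unconj (y j))) ` carrier ?Y \<subseteq> carrier ?X"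
    proof clarify
      fix y assume y: "y \<in> carrier ?Y"
      have "{j \<in> J. (\<lambda>j\<in>J. unconj (y j)) j \<noteq> \<zero>\<^bsub>W j\<^esub>} = {j \<in> J. y j \<noteq> Conj \<zero>\<^bsub>W j\<^esub>}"
        by (auto simp: conj.expand)
      then show "Conj (\<lambda>j\<in>J. unconj (y j)) \<in> carrier ?X" using y by (auto simp: X Y PiE_iff)
    qed
  qed
  have "linear_map ?X ?Y (pi_map J)"
    by (rule linear_mapI, erule into)
      (auto simp: X conj_hmod_def direct_sum_hmod_def simp del: direct_sum_space_sel(1) intro!: restrict_ext)
  moreover have "pi_map J (a \<rhd>\<^bsub>?X\<^esub> x) = a \<rhd>\<^bsub>?Y\<^esub> pi_map J x" if "a \<in> carrier H" for a x
    by (cases x) (auto simp: conj_hmod_def direct_sum_hmod_def intro!: restrict_ext)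
  moreover have "hmodule H ?X" "hmodule H ?Y"
    by (intro hmodule_conj_hmod hmodule_direct_sum_hmod vspace_H W; assumption)+
  ultimately show ?thesis
    using bij by (simp add: hmodule_iso_def hmodule_hom_def)
qed

end

theorem proposition4p7:
  fixes H :: "'h hopf_star"
    and V :: "('h, 'v) hmod"
    and J :: "'j set"
    and W :: "'j \<Rightarrow> ('h, 'w) hmod"
  assumes "hopf_star_algebra H"
    and "hmodule H V"
    and "\<And>j. j \<in> J \<Longrightarrow> hmodule H (W j)"
  shows "hmodule_iso H (conj_hmod H (trivial_hmod H)) (trivial_hmod H) gamma_map \<and>
    hmodule_iso H (conj_hmod H (conj_hmod H V)) V sigma_map \<and>
    hmodule_iso H (conj_hmod H (direct_sum_hmod J W)) (direct_sum_hmod J (\<lambda>j. conj_hmod H (W j)))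
      (pi_map J)"
proof -
  interpret hopf_star_algebra H by fact
  show ?thesis using hmodule_iso_gamma hmodule_iso_sigma[OF assms(2)] hmodule_iso_pi[OF assms(3)] by simp
qed

end
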